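(* Let $I\subseteq\overline{\mathbb R}[x_1^{\pm1},\dots,x_n^{\pm1}]$ be a zero-dimensional tropical ideal. Then $$\deg(I)=\sum_{\mathbf w\in V(I)}\operatorname{mult}_{V(I)}(\mathbf w).$$
   Context: $\overline{\mathbb R}=(\mathbb R\cup\{\infty\},\min,+)$, $\mathbb B=\{0,\infty\}$. $[f]_{\mathbf x^{\mathbf u}}$ is the coefficient of $\mathbf x^{\mathbf u}$, $f(\mathbf w)=\min_{\mathbf u}([f]_{\mathbf x^{\mathbf u}}+\mathbf u\cdot\mathbf w)$. Tropical ideal (over $\overline{\mathbb R}$ or $\mathbb B$): for $f,g\in I$ and $\mathbf x^{\mathbf u}$ with $[f]_{\mathbf x^{\mathbf u}}=[g]_{\mathbf x^{\mathbf u}}\ne\infty$ there is $h\in I$ with $[h]_{\mathbf x^{\mathbf u}}=\infty$ and $[h]_{\mathbf x^{\mathbf v}}\ge\min([f]_{\mathbf x^{\mathbf v}},[g]_{\mathbf x^{\mathbf v}})$ for all $\mathbf v$, with equality when $[f]_{\mathbf x^{\mathbf v}}\ne[g]_{\mathbf x^{\mathbf v}}$. $V(I)=\{\mathbf w\in\mathbb R^n:$ for every $f\in I$, $f\ne\infty$, the minimum in $f(\mathbf w)$ is attained at least twice$\}$. Dimension/degree: for homogeneous tropical $J\subseteq K[x_0,\dots,x_n]$ ($K=\overline{\mathbb R}$ or $\mathbb B$), $H_J(e)$ is the maximum size of a set of degree-$e$ monomials containing the support of no element $\ne\infty$ of $J$; it agrees with a polynomial (the Hilbert polynomial) for $e\gg0$;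 $\dim J$ is the degree of that polynomial, and when $J$ is zero-dimensional its degree $\deg J$ is the constant value of the Hilbert polynomial. For a Laurent ideal $I$, $\dim I$ and $\deg I$ are those of the homogenization of $I\cap K[x_1,\dots,x_n]$ (the ideal generated by $\bigoplus c_{\mathbf u}x_0^{D-|\mathbf u|}\mathbf x^{\mathbf u}$, $D=\max\{|\mathbf u|:c_{\mathbf u}\ne\infty\}$, for its elements). Multiplicity: $\operatorname{in}_{\mathbf w}(f)=\bigoplus_{\mathbf u:[f]_{\mathbf x^{\mathbf u}}+\mathbf u\cdot\mathbf w=f(\mathbf w)}\mathbf x^{\mathbf u}$, $\operatorname{in}_{\mathbf w}(I)=\{\operatorname{in}_{\mathbf w}(f):f\in I\}\subseteq\mathbb B[x_1^{\pm1},\dots,x_n^{\pm1}]$ (a zero-dimensional tropical ideal), and $\operatorname{mult}_{V(I)}(\mathbf w)=\deg(\operatorname{in}_{\mathbf w}(I))$. *)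

theory Defs
  imports "HOL-Computational_Algebra.Polynomial"
begin

text \<open>The tropical semiring (R u {infinity}, min, +). TInf is the tropical zero (infinity).
  The Boolean semiring B = {0, infinity} is the subset {Fin 0, TInf}.\<close>

datatype trop = Fin real | TInf

fun tmin :: "trop \<Rightarrow> trop \<Rightarrow> trop" where
  "tmin TInf b = b"
| "tmin a TInf = a"
| "tmin (Fin a) (Fin b) = Fin (min a b)"

fun tplus :: "trop \<Rightarrow> trop \<Rightarrow> trop" where
  "tplus (Fin a) (Fin b) = Fin (a + b)"
| "tplus _ _ = TInf"

fun tle :: "trop \<Rightarrow> trop \<Rightarrow> bool" where
  "tle _ TInf = True"
| "tle TInf (Fin _) = False"
| "tle (Fin a) (Fin b) = (a \<le> b)"

text \<open>Exponent vectors in Z^n are functions nat => int vanishing from index n on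
  (index i stands for variable x_(i+1)). A (Laurent) polynomial is a map from exponent
  vectors to coefficients with finite support inside Z^n. The parameter scal is the set of
  allowed finite coefficients: UNIV for the tropical reals, {0} for the Boolean semiring.\<close>

definition expo :: "nat \<Rightarrow> (nat \<Rightarrow> int) set" where
  "expo n = {u. \<forall>i\<ge>n. u i = 0}"

definition supp :: "((nat \<Rightarrow> int) \<Rightarrow> trop) \<Rightarrow> (nat \<Rightarrow> int) set" where
  "supp f = {u. f u \<noteq> TInf}"

definition coeffs_in :: "real set \<Rightarrow> ((nat \<Rightarrow> int) \<Rightarrow> trop) \<Rightarrow> bool" where
  "coeffs_in scal f \<longleftrightarrow> (\<forall>u. f u \<noteq> TInf \<longrightarrow> (\<exists>c\<in>scal. f u = Fin c))"

definition laurent_poly :: "real set \<Rightarrow> nat \<Rightarrow> ((nat \<Rightarrow> int) \<Rightarrow> trop) \<Rightarrow> bool" where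
  "laurent_poly scal n f \<longleftrightarrow> finite (supp f) \<and> supp f \<subseteq> expo n \<and> coeffs_in scal f"

definition ord_poly :: "real set \<Rightarrow> nat \<Rightarrow> ((nat \<Rightarrow> int) \<Rightarrow> trop) \<Rightarrow> bool" where
  "ord_poly scal n f \<longleftrightarrow> laurent_poly scal n f \<and> (\<forall>u\<in>supp f. \<forall>i. 0 \<le> u i)"

definition tzero :: "(nat \<Rightarrow> int) \<Rightarrow> trop" where
  "tzero = (\<lambda>u. TInf)"

definition padd :: "((nat \<Rightarrow> int) \<Rightarrow> trop) \<Rightarrow> ((nat \<Rightarrow> int) \<Rightarrow> trop) \<Rightarrow> (nat \<Rightarrow> int) \<Rightarrow> trop" where
  "padd f g = (\<lambda>u. tmin (f u) (g u))"

definition mono_mult :: "real \<Rightarrow> (nat \<Rightarrow> int) \<Rightarrow> ((nat \<Rightarrow> int) \<Rightarrow> trop) \<Rightarrow> (nat \<Rightarrow> int) \<Rightarrow> trop" where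
  "mono_mult c v f = (\<lambda>u. tplus (Fin c) (f (\<lambda>i. u i - v i)))"

definition elimination_axiom :: "((nat \<Rightarrow> int) \<Rightarrow> trop) set \<Rightarrow> bool" where
  "elimination_axiom I \<longleftrightarrow>
     (\<forall>f\<in>I. \<forall>g\<in>I. \<forall>u. f u = g u \<and> f u \<noteq> TInf \<longrightarrow>
        (\<exists>h\<in>I. h u = TInf \<and>
           (\<forall>v. tle (tmin (f v) (g v)) (h v) \<and>
                (f v \<noteq> g v \<longrightarrow> h v = tmin (f v) (g v)))))"

text \<open>A tropical ideal of the Laurent polynomial semiring K[x_1^(+-1),...,x_n^(+-1)]:
  an ideal (contains infinity, closed under tropical sum and under multiplication by terms,
  hence by all Laurent polynomials) satisfying the elimination axiom.\<close>
definition trop_laurent_ideal :: "real set \<Rightarrow> nat \<Rightarrow> ((nat \<Rightarrow> int) \<Rightarrow> trop) set \<Rightarrow> bool" where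
  "trop_laurent_ideal scal n I \<longleftrightarrow>
     I \<subseteq> {f. laurent_poly scal n f} \<and> tzero \<in> I \<and>
     (\<forall>f\<in>I. \<forall>g\<in>I. padd f g \<in> I) \<and>
     (\<forall>f\<in>I. \<forall>c\<in>scal. \<forall>v\<in>expo n. mono_mult c v f \<in> I) \<and>
     elimination_axiom I"

definition tot_deg :: "nat \<Rightarrow> (nat \<Rightarrow> int) \<Rightarrow> int" where
  "tot_deg n u = (\<Sum>i<n. u i)"

text \<open>Homogenization of f in K[x_1..x_n]; the homogenizing variable x_0 has index n.\<close>
definition homog :: "nat \<Rightarrow> ((nat \<Rightarrow> int) \<Rightarrow> trop) \<Rightarrow> (nat \<Rightarrow> int) \<Rightarrow> trop" where
  "homog n f = (let D = Max (tot_deg n ` supp f) in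
     (\<lambda>v. if v n = D - tot_deg n v then f (v(n := 0)) else TInf))"

inductive_set gen_ideal :: "real set \<Rightarrow> nat \<Rightarrow> ((nat \<Rightarrow> int) \<Rightarrow> trop) set \<Rightarrow> ((nat \<Rightarrow> int) \<Rightarrow> trop) set"
  for scal :: "real set" and m :: nat and G :: "((nat \<Rightarrow> int) \<Rightarrow> trop) set" where
  gen: "f \<in> G \<Longrightarrow> f \<in> gen_ideal scal m G"
| zero: "tzero \<in> gen_ideal scal m G"
| add: "f \<in> gen_ideal scal m G \<Longrightarrow> g \<in> gen_ideal scal m G \<Longrightarrow> padd f g \<in> gen_ideal scal m G"
| mult: "f \<in> gen_ideal scal m G \<Longrightarrow> c \<in> scal \<Longrightarrow> v \<in> expo m \<Longrightarrow> (\<forall>i. 0 \<le> v i) \<Longrightarrow>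
           mono_mult c v f \<in> gen_ideal scal m G"

definition hom_ideal :: "real set \<Rightarrow> nat \<Rightarrow> ((nat \<Rightarrow> int) \<Rightarrow> trop) set \<Rightarrow> ((nat \<Rightarrow> int) \<Rightarrow> trop) set" where
  "hom_ideal scal n I = gen_ideal scal (Suc n) (homog n ` {f \<in> I. ord_poly scal n f})"

definition deg_monos :: "nat \<Rightarrow> nat \<Rightarrow> (nat \<Rightarrow> int) set" where
  "deg_monos m e = {u \<in> expo m. (\<forall>i. 0 \<le> u i) \<and> tot_deg m u = int e}"

definition hilbert_fun :: "nat \<Rightarrow> ((nat \<Rightarrow> int) \<Rightarrow> trop) set \<Rightarrow> nat \<Rightarrow> nat" where
  "hilbert_fun m J e = Max {card S | S. S \<subseteq> deg_monos m e \<and>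
      (\<forall>f\<in>J. f \<noteq> tzero \<longrightarrow> \<not> supp f \<subseteq> S)}"

definition is_hilbert_poly :: "nat \<Rightarrow> ((nat \<Rightarrow> int) \<Rightarrow> trop) set \<Rightarrow> real poly \<Rightarrow> bool" where
  "is_hilbert_poly m J p \<longleftrightarrow> (\<exists>e0. \<forall>e\<ge>e0. real (hilbert_fun m J e) = poly p (real e))"

definition laurent_hpoly :: "real set \<Rightarrow> nat \<Rightarrow> ((nat \<Rightarrow> int) \<Rightarrow> trop) set \<Rightarrow> real poly" where
  "laurent_hpoly scal n I = (THE p. is_hilbert_poly (Suc n) (hom_ideal scal n I) p)"

definition tdim :: "real set \<Rightarrow> nat \<Rightarrow> ((nat \<Rightarrow> int) \<Rightarrow> trop) set \<Rightarrow> nat" where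
  "tdim scal n I = degree (laurent_hpoly scal n I)"

definition zero_dimensional :: "real set \<Rightarrow> nat \<Rightarrow> ((nat \<Rightarrow> int) \<Rightarrow> trop) set \<Rightarrow> bool" where
  "zero_dimensional scal n I \<longleftrightarrow>
     (\<exists>p. is_hilbert_poly (Suc n) (hom_ideal scal n I) p) \<and> tdim scal n I = 0"

text \<open>Degree of a zero-dimensional ideal: the constant value of the Hilbert polynomial.\<close>
definition tdeg :: "real set \<Rightarrow> nat \<Rightarrow> ((nat \<Rightarrow> int) \<Rightarrow> trop) set \<Rightarrow> real" where
  "tdeg scal n I = poly (laurent_hpoly scal n I) 0"

definition rvec :: "nat \<Rightarrow> (nat \<Rightarrow> real) set" where
  "rvec n = {w. \<forall>i\<ge>n. w i = 0}"

definition dotp :: "nat \<Rightarrow> (nat \<Rightarrow> int) \<Rightarrow> (nat \<Rightarrow> real) \<Rightarrow> real" where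
  "dotp n u w = (\<Sum>i<n. of_int (u i) * w i)"

text \<open>f(w) for f \<noteq> infinity.\<close>
definition teval :: "nat \<Rightarrow> ((nat \<Rightarrow> int) \<Rightarrow> trop) \<Rightarrow> (nat \<Rightarrow> real) \<Rightarrow> real" where
  "teval n f w = Min {c + dotp n u w | u c. f u = Fin c}"

definition min_terms :: "nat \<Rightarrow> ((nat \<Rightarrow> int) \<Rightarrow> trop) \<Rightarrow> (nat \<Rightarrow> real) \<Rightarrow> (nat \<Rightarrow> int) set" where
  "min_terms n f w = {u. \<exists>c. f u = Fin c \<and> c + dotp n u w = teval n f w}"

definition trop_variety :: "nat \<Rightarrow> ((nat \<Rightarrow> int) \<Rightarrow> trop) set \<Rightarrow> (nat \<Rightarrow> real) set" where
  "trop_variety n I = {w \<in> rvec n. \<forall>f\<in>I. f \<noteq> tzero \<longrightarrow> 2 \<le> card (min_terms n f w)}"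

definition init_form :: "nat \<Rightarrow> (nat \<Rightarrow> real) \<Rightarrow> ((nat \<Rightarrow> int) \<Rightarrow> trop) \<Rightarrow> (nat \<Rightarrow> int) \<Rightarrow> trop" where
  "init_form n w f = (\<lambda>u. if f \<noteq> tzero \<and> u \<in> min_terms n f w then Fin 0 else TInf)"

definition init_ideal :: "nat \<Rightarrow> (nat \<Rightarrow> real) \<Rightarrow> ((nat \<Rightarrow> int) \<Rightarrow> trop) set \<Rightarrow> ((nat \<Rightarrow> int) \<Rightarrow> trop) set" where
  "init_ideal n w I = init_form n w ` I"

definition mult :: "nat \<Rightarrow> ((nat \<Rightarrow> int) \<Rightarrow> trop) set \<Rightarrow> (nat \<Rightarrow> real) \<Rightarrow> real" where
  "mult n I w = tdeg {0} n (init_ideal n w I)"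

end

theory Submission
  imports Defs "HOL-Analysis.Function_Topology"
begin

text \<open>Dehomogenizing identifies the degree of a zero-dimensional ideal with its rank: the maximal
  size of a set of Laurent monomials containing the support of no nonzero element. Let \<open>d\<close> be
  the rank of \<open>I\<close> and \<open>r(w)\<close> that of the initial ideal at \<open>w\<close>; \<open>r(w) = 0\<close> for \<open>w\<close> outside the
  variety, since there the initial ideal contains a monomial.

  Upper bound: given independent sets for the initial ideals at finitely many distinct points
  \<open>w\<close>, translate each by (roughly) \<open>- K w\<close>. For \<open>K\<close> large the union is independent for \<open>I\<close>, whence
  \<open>\<Sum> r(w) \<le> d\<close> and the variety is finite.

  Lower bound: for the weight \<open>- |u|\<^sup>2 / 2K\<close> on a large box there are \<open>d\<close> monomials \<open>B\<close> containing no
  weighted initial support. The points \<open>- b / K\<close> for \<open>b \<in> B\<close> stay in a fixed compact cube. Near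
  \<open>- K w\<close> the weight is almost linear with slope \<open>w\<close>, and every monomial there is congruent modulo
  \<open>I\<close> to a combination of \<open>r(w)\<close> fixed ones up to an error of valuation proportional to \<open>K\<close>; so at
  most \<open>r(w)\<close> elements of \<open>B\<close> satisfy \<open>- b / K \<approx> w\<close>. A finite cover of the cube gives
  \<open>d \<le> \<Sum> r(w)\<close>.\<close>

section \<open>Tropical linear spaces\<close>

text \<open>A tropical ideal need not come from an ideal over a field, so there are no roots to
  count. The substitute is tropical Gaussian elimination made quantitative: a set \<open>T\<close>
  spans \<open>b\<close> up to error \<open>E\<close> if some vector is \<open>0\<close> at
  \<open>b\<close>, nonnegative on \<open>T\<close> and at least \<open>E\<close> elsewhere.
  Steinitz exchange holds for this notion, and \<open>E = TInf\<close> gives exact dependence. Both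
  bounds rest on one Legendre pair. The upper bound weighs a monomial u at a point w by u.w +
  K|w|^2/2. The minimum of this over all w is -|u|^2/2K, attained at w = -u/K, and that minimum is
  the weight of the lower bound. Its slope -u/K takes every value as u varies, so one weight sees
  all points of the variety at once and each b in B is charged to the point -b/K. The obstacle in
  the lower bound is that B is independent for a quadratic weight, while \<open>r(w)\<close>
  concerns a linear one. A relation whose gap does not grow with \<open>K\<close> would be drowned
  by the quadratic discrepancy, so gaps must grow with \<open>K\<close> while supports stay within a
  small multiple of \<open>K\<close>.\<close>

instantiation trop :: linorder
begin

definition "x \<le> y \<longleftrightarrow> tle x y" for x y :: trop
definition "x < y \<longleftrightarrow> tle x y \<and> \<not> tle y x" for x y :: trop

instance
proof
  fix x y z :: trop
  show "x < y \<longleftrightarrow> x \<le> y \<and> \<not> y \<le> x"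
    by (simp add: less_eq_trop_def less_trop_def)
  show "x \<le> x"
    by (cases x) (auto simp: less_eq_trop_def)
  show "x \<le> z" if "x \<le> y" "y \<le> z"
    using that by (cases x; cases y; cases z) (auto simp: less_eq_trop_def)
  show "x = y" if "x \<le> y" "y \<le> x"
    using that by (cases x; cases y) (auto simp: less_eq_trop_def)
  show "x \<le> y \<or> y \<le> x"
    by (cases x; cases y) (auto simp: less_eq_trop_def)
qed

end

text \<open>The class constant \<open>0\<close> is \<open>Fin 0\<close>, the unit of tropical
  multiplication; the tropical zero \<open>TInf\<close> is the greatest element. A condition
  \<open>0 \<le> f v\<close> thus says that the coefficient at \<open>v\<close> has nonnegative
  valuation, and it holds for absent terms.\<close>

instantiation trop :: ordered_comm_monoid_add
begin

definition "0 = Fin 0"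
definition "x + y = tplus x y" for x y :: trop

instance
proof
  fix x y z :: trop
  show "x + y + z = x + (y + z)"
    by (cases x; cases y; cases z) (auto simp: plus_trop_def)
  show "x + y = y + x"
    by (cases x; cases y) (auto simp: plus_trop_def)
  show "0 + x = x"
    by (cases x) (auto simp: plus_trop_def zero_trop_def)
  show "z + x \<le> z + y" if "x \<le> y"
    using that by (cases x; cases y; cases z) (auto simp: plus_trop_def less_eq_trop_def)
qed

end

lemma trop_le_simps [simp]:
  "x \<le> TInf" "TInf \<le> Fin a \<longleftrightarrow> False" "Fin a \<le> Fin b \<longleftrightarrow> a \<le> b"
  by (auto simp: less_eq_trop_def)

lemma trop_less_simps [simp]:
  "TInf < x \<longleftrightarrow> False" "Fin a < TInf" "Fin a < Fin b \<longleftrightarrow> a < b"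
  by (auto simp: less_trop_def)

lemma trop_plus_simps [simp]:
  "Fin a + Fin b = Fin (a + b)" "TInf + x = TInf" "x + TInf = TInf"
  by (cases x; auto simp: plus_trop_def)+

lemma TInf_le_iff [simp]: "TInf \<le> x \<longleftrightarrow> x = TInf"
  by (cases x) auto

lemma zero_le_Fin [simp]: "0 \<le> Fin a \<longleftrightarrow> 0 \<le> a" "0 < Fin a \<longleftrightarrow> 0 < a" "0 < TInf" "0 \<noteq> TInf" "TInf \<noteq> 0"
  by (auto simp: zero_trop_def)

lemma tmin_eq_min: "tmin x y = min x y"
  by (cases x; cases y) (auto simp: min_def)

lemma trop_plus_eq_TInf_iff [simp]: "x + y = TInf \<longleftrightarrow> x = TInf \<or> y = TInf"
  by (cases x; cases y) auto

lemma mono_mult_eq: "mono_mult c v f = (\<lambda>u. Fin c + f (\<lambda>i. u i - v i))"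
  by (simp add: mono_mult_def plus_trop_def)

lemma padd_eq: "padd f g = (\<lambda>u. min (f u) (g u))"
  by (simp add: padd_def tmin_eq_min)

section \<open>Elimination and quantitative Steinitz exchange\<close>

type_synonym tvec = "(nat \<Rightarrow> int) \<Rightarrow> trop"

text \<open>These are the two row operations of Gaussian elimination: scaling a vector, and
  cancelling an entry between two vectors. The notion is stable under adding a weight to each
  coordinate, so linear and quadratic weights fall under the same lemmas.\<close>

definition trop_linear_space :: "tvec set \<Rightarrow> bool" where
  "trop_linear_space X \<longleftrightarrow>
     elimination_axiom X \<and> (\<forall>f\<in>X. \<forall>c. (\<lambda>u. Fin c + f u) \<in> X)"

lemma trop_linear_space_scale:
  "trop_linear_space X \<Longrightarrow> f \<in> X \<Longrightarrow> (\<lambda>u. Fin c + f u) \<in> X"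
  by (auto simp: trop_linear_space_def)

text \<open>Rescaling \<open>g\<close> by \<open>f y\<close> makes the two vectors agree at
  \<open>y\<close>. The equality where they differ is what preserves a normalized entry: a value
  strictly below its competitor survives the cancellation.\<close>

lemma eliminate:
  assumes "trop_linear_space X" "f \<in> X" "g \<in> X" "f y \<noteq> TInf" "g y = 0"
  obtains h where "h \<in> X" "h y = TInf"
    "\<And>v. min (f v) (f y + g v) \<le> h v"
    "\<And>v. f v \<noteq> f y + g v \<Longrightarrow> h v = min (f v) (f y + g v)"
    "supp h \<subseteq> supp f \<union> supp g"
proof -
  obtain a where a: "f y = Fin a"
    using assms(4) by (cases "f y") auto
  have g': "(\<lambda>u. f y + g u) \<in> X"
    using trop_linear_space_scale[OF assms(1,3), of a] a by simp
  have "\<forall>f\<in>X. \<forall>g\<in>X. \<forall>u. f u = g u \<and> f u \<noteq> TInf \<longrightarrow> (\<exists>h\<in>X. h u = TInf \<and>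
          (\<forall>v. min (f v) (g v) \<le> h v \<and> (f v \<noteq> g v \<longrightarrow> h v = min (f v) (g v))))"
    using assms(1)
    unfolding trop_linear_space_def elimination_axiom_def tmin_eq_min less_eq_trop_def
    by (rule conjunct1)
  from this[THEN bspec, OF assms(2), THEN bspec, OF g', THEN spec, of y]
  obtain h where h: "h \<in> X" "h y = TInf"
    "\<forall>v. min (f v) (f y + g v) \<le> h v \<and> (f v \<noteq> f y + g v \<longrightarrow> h v = min (f v) (f y + g v))"
    using assms(4,5) by auto
  have "h v = TInf" if "f v = TInf" "g v = TInf" for v
    using h(3)[rule_format, of v] that by simp
  then have "supp h \<subseteq> supp f \<union> supp g"
    by (auto simp: supp_def)
  with h that show thesis by blast
qed

text \<open>The terms of \<open>f\<close> in \<open>Y\<close> are cancelled one at a time.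
  Cancelling \<open>y\<close> brings in only \<open>f y + g v\<close>, which is at least
  \<open>m + \<delta>\<close> outside \<open>T\<close> and \<open>y\<close>; hence the remaining
  terms of \<open>Y\<close> stay at least \<open>m\<close>, and the entry \<open>0\<close> at
  \<open>b\<close> is never undercut. The net effect is to raise the gap from \<open>m\<close> to
  \<open>m + \<delta>\<close>.\<close>

lemma reduce_terms:
  assumes X: "trop_linear_space X"
    and Y: "finite Y" "b \<notin> Y" "Y \<inter> T = {}" and b: "b \<notin> T"
    and \<delta>: "0 < \<delta>" and m: "0 \<le> m"
    and g: "\<And>y. y \<in> Y \<Longrightarrow> \<exists>g\<in>X. g y = 0 \<and> (\<forall>t\<in>T. 0 \<le> g t) \<and>
              (\<forall>v. v \<notin> insert y T \<longrightarrow> \<delta> \<le> g v) \<and> supp g \<subseteq> Z"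
    and f: "f \<in> X" "f b = 0" "\<And>t. t \<in> T \<Longrightarrow> 0 \<le> f t" "\<And>y. y \<in> Y \<Longrightarrow> m \<le> f y"
      "\<And>v. v \<notin> T \<Longrightarrow> v \<noteq> b \<Longrightarrow> v \<notin> Y \<Longrightarrow> m + \<delta> \<le> f v" "supp f \<subseteq> Z"
  shows "\<exists>h\<in>X. h b = 0 \<and> (\<forall>t\<in>T. 0 \<le> h t) \<and>
           (\<forall>v. v \<notin> insert b T \<longrightarrow> m + \<delta> \<le> h v) \<and> supp h \<subseteq> Z"
  using Y g f
proof (induction Y arbitrary: f rule: finite_induct)
  case empty
  then show ?case by auto
next
  case (insert y Y)
  note f = insert.prems(4-9)
  obtain g where g: "g \<in> X" "g y = 0" "\<And>t. t \<in> T \<Longrightarrow> 0 \<le> g t"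
    "\<And>v. v \<notin> insert y T \<Longrightarrow> \<delta> \<le> g v" "supp g \<subseteq> Z"
    using insert.prems(3)[of y] by blast
  have "\<exists>h\<in>X. h b = 0 \<and> (\<forall>t\<in>T. 0 \<le> h t) \<and> (\<forall>z\<in>Y. m \<le> h z) \<and>
          (\<forall>v. v \<notin> T \<longrightarrow> v \<noteq> b \<longrightarrow> v \<notin> Y \<longrightarrow> m + \<delta> \<le> h v) \<and> supp h \<subseteq> Z"
  proof (cases "f y = TInf")
    case True
    have "m + \<delta> \<le> f v" if "v \<notin> T" "v \<noteq> b" "v \<notin> Y" for v
      using f(5)[of v] that True by (cases "v = y") auto
    with f show ?thesis
      by (intro bexI[of _ f]) auto
  next
    case False
    obtain h where h: "h \<in> X" "h y = TInf" "\<And>v. min (f v) (f y + g v) \<le> h v"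
      "\<And>v. f v \<noteq> f y + g v \<Longrightarrow> h v = min (f v) (f y + g v)" "supp h \<subseteq> supp f \<union> supp g"
      using eliminate[OF X f(1) g(1) False g(2)] by blast
    have my: "m \<le> f y"
      using f(4) by blast
    have big: "m + \<delta> \<le> f y + g v" if "v \<notin> insert y T" for v
      using add_mono[OF my g(4)[OF that]] .
    have "0 < m + \<delta>"
      using m \<delta> by (cases m; cases \<delta>) auto
    then have "0 < f y + g b"
      using big[of b] b insert.prems(1) by (force dest: less_le_trans)
    then have "h b = 0"
      using h(4)[of b] f(2) by (metis less_imp_le less_irrefl min.absorb1)
    moreover have "0 \<le> h t" if "t \<in> T" for t
      using order_trans[OF _ h(3)[of t], of 0] f(3)[OF that]
        add_nonneg_nonneg[OF order_trans[OF m my] g(3)[OF that]] by simp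
    moreover have "m \<le> h z" if "z \<in> Y" for z
    proof -
      have "z \<notin> insert y T"
        using that insert.hyps insert.prems(2) by auto
      then have "m \<le> f y + g z"
        using add_mono[OF my, of 0 "g z"] g(4)[of z] \<delta> by auto
      then show ?thesis
        using order_trans[OF _ h(3)[of z], of m] f(4)[of z] that by simp
    qed
    moreover have "m + \<delta> \<le> h v" if "v \<notin> T" "v \<noteq> b" "v \<notin> Y" for v
    proof (cases "v = y")
      case True
      then show ?thesis using h(2) by simp
    next
      case False
      then show ?thesis
        using order_trans[OF _ h(3)[of v], of "m + \<delta>"] f(5)[of v] big[of v] that by simp
    qed
    moreover have "supp h \<subseteq> Z"
      using h(5) f(6) g(5) by blast
    ultimately show ?thesis
      using h(1) by blast
  qed
  then obtain h where h: "h \<in> X" "h b = 0" "\<forall>t\<in>T. 0 \<le> h t" "\<forall>z\<in>Y. m \<le> h z"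
    "\<forall>v. v \<notin> T \<longrightarrow> v \<noteq> b \<longrightarrow> v \<notin> Y \<longrightarrow> m + \<delta> \<le> h v" "supp h \<subseteq> Z"
    by (elim bexE conjE)
  show ?case
  proof (rule insert.IH[of h])
    show "b \<notin> Y" "Y \<inter> T = {}"
      using insert.prems(1,2) by auto
    show "\<exists>g\<in>X. g z = 0 \<and> (\<forall>t\<in>T. 0 \<le> g t) \<and>
            (\<forall>v. v \<notin> insert z T \<longrightarrow> \<delta> \<le> g v) \<and> supp g \<subseteq> Z" if "z \<in> Y" for z
      using insert.prems(3)[of z] that by simp
  qed (use h in simp_all)
qed

text \<open>Elements of \<open>T - S\<close> are traded for elements of \<open>S\<close> until
  \<open>T\<close> is a proper subset of \<open>S\<close>; then the relation of any leftover
  \<open>b\<close> is already concentrated on \<open>S\<close> up to \<open>E\<close>. A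
  \<open>t\<close> whose entries in all relations are at least \<open>E\<close> contributes only
  error and is dropped without replacement.\<close>

lemma exchange:
  assumes X: "trop_linear_space X" and E: "0 < E"
    and fin: "finite S" "finite T" and card: "card T < card S"
    and rel: "\<And>b. b \<in> S - T \<Longrightarrow> \<exists>f\<in>X. f b = 0 \<and> (\<forall>t\<in>T. 0 \<le> f t) \<and>
              (\<forall>v. v \<notin> insert b T \<longrightarrow> E \<le> f v) \<and> supp f \<subseteq> Z"
  shows "\<exists>f\<in>X. (\<forall>v\<in>S. 0 \<le> f v) \<and> (\<exists>v\<in>S. f v = 0) \<and> (\<forall>v. v \<notin> S \<longrightarrow> E \<le> f v) \<and> supp f \<subseteq> Z"
  using fin card rel
proof (induction "card (T - S)" arbitrary: T)
  case 0
  then have TS: "T \<subseteq> S" by auto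
  moreover have "T \<noteq> S" using 0 by auto
  ultimately obtain b where b: "b \<in> S - T" by blast
  obtain f where f: "f \<in> X" "f b = 0" "\<forall>t\<in>T. 0 \<le> f t" "\<forall>v. v \<notin> insert b T \<longrightarrow> E \<le> f v" "supp f \<subseteq> Z"
    using 0(5)[OF b] by blast
  have "0 \<le> f v" if "v \<in> S" for v
    using f E by (cases "v \<in> insert b T") (auto intro: order_trans[OF less_imp_le])
  moreover have "E \<le> f v" if "v \<notin> S" for v
    using f(4) b TS that by (metis DiffD1 insertE subsetD)
  ultimately show ?case
    using f b by blast
next
  case (Suc k)
  then obtain t where t: "t \<in> T" "t \<notin> S"
    by (metis Diff_iff card.empty equals0I old.nat.distinct(1))
  have k: "k = card (T - {t} - S)"
  proof -
    have "T - {t} - S = T - S - {t}" by auto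
    then show ?thesis using Suc(2) t by simp
  qed
  from Suc.prems(4) obtain F where F:
    "\<And>b. b \<in> S - T \<Longrightarrow> F b \<in> X \<and> F b b = 0 \<and> (\<forall>t\<in>T. 0 \<le> F b t) \<and>
              (\<forall>v. v \<notin> insert b T \<longrightarrow> E \<le> F b v) \<and> supp (F b) \<subseteq> Z"
    by metis
  show ?case
  proof (cases "\<forall>b\<in>S - T. E \<le> F b t")
    case True
    show ?thesis
    proof (rule Suc.hyps(1)[of "T - {t}"])
      show "k = card (T - {t} - S)" by (fact k)
      show "card (T - {t}) < card S"
        using Suc.prems t by (meson card_Diff1_le le_less_trans)
      fix b assume "b \<in> S - (T - {t})"
      then have "b \<in> S - T" using t by auto
      with F[OF this] True show "\<exists>f\<in>X. f b = 0 \<and> (\<forall>t\<in>T - {t}. 0 \<le> f t) \<and>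
              (\<forall>v. v \<notin> insert b (T - {t}) \<longrightarrow> E \<le> f v) \<and> supp f \<subseteq> Z"
        by (intro bexI[of _ "F b"]) auto
    qed (use Suc.prems in auto)
  next
    case False
    then have ne: "(\<lambda>b. F b t) ` (S - T) \<noteq> {}" by auto
    have fi: "finite ((\<lambda>b. F b t) ` (S - T))" using Suc.prems by auto
    \<comment> \<open>The pivot row is the one with the smallest entry at \<open>t\<close>. Solving
      it for \<open>t\<close> may create a negative entry at \<open>b\<close>, but any other row
      uses it with a multiplier that is at least the pivot value.\<close>
    obtain b where b: "b \<in> S - T" "F b t = Min ((\<lambda>b. F b t) ` (S - T))"
      using Min_in[OF fi ne] by auto
    have min: "F b t \<le> F b' t" if "b' \<in> S - T" for b'
      using b(2) fi that by auto
    have "F b t < E"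
      using False min by (meson le_less_trans not_le)
    then obtain a where a: "F b t = Fin a"
      by (cases "F b t") auto
    have a0: "0 \<le> a" using F[OF b(1)] t(1) a by force
    define g where "g = (\<lambda>u. Fin (-a) + F b u)"
    have g: "g \<in> X" "g t = 0" "supp g \<subseteq> Z"
      using F[OF b(1)] trop_linear_space_scale[OF X] a
      by (auto simp: g_def zero_trop_def supp_def)
    have tb: "t \<noteq> b" using t b by auto
    show ?thesis
    proof (rule Suc.hyps(1)[of "insert b (T - {t})"])
      show "k = card (insert b (T - {t}) - S)"
        using k b by (simp add: insert_Diff_if)
      show "card (insert b (T - {t})) < card S"
        using Suc.prems t b card_Suc_Diff1[of T t] by simp
      fix b' assume "b' \<in> S - insert b (T - {t})"
      then have b': "b' \<in> S - T" "b' \<noteq> b" "b' \<noteq> t" using t by auto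
      note Fb' = F[OF b'(1)]
      show "\<exists>f\<in>X. f b' = 0 \<and> (\<forall>t\<in>insert b (T - {t}). 0 \<le> f t) \<and>
              (\<forall>v. v \<notin> insert b' (insert b (T - {t})) \<longrightarrow> E \<le> f v) \<and> supp f \<subseteq> Z"
      proof (cases "F b' t = TInf")
        case True
        have "0 \<le> F b' b"
          using Fb' E b b' by (auto intro: order_trans[OF less_imp_le])
        then show ?thesis
          using Fb' True by (intro bexI[of _ "F b'"]) auto
      next
        case False
        then obtain c where c: "F b' t = Fin c" by (cases "F b' t") auto
        have ac: "a \<le> c" using min[OF b'(1)] a c by simp
        obtain h where h: "h \<in> X" "h t = TInf" "\<And>v. min (F b' v) (F b' t + g v) \<le> h v"
          "\<And>v. F b' v \<noteq> F b' t + g v \<Longrightarrow> h v = min (F b' v) (F b' t + g v)"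
          "supp h \<subseteq> supp (F b') \<union> supp g"
          using eliminate[OF X conjunct1[OF Fb'] g(1) False g(2)] by blast
        \<comment> \<open>Minimality of the pivot: the added multiple is \<open>F b\<close> scaled
          by \<open>c - a \<ge> 0\<close>, so every lower bound known for \<open>F b\<close> carries
          over.\<close>
        have ge: "F b v \<le> F b' t + g v" for v
          using ac c by (cases "F b v") (auto simp: g_def)
        have "E \<le> F b b'"
          using F[OF b(1)] b' by auto
        then have "0 < F b' t + g b'"
          using ge[of b'] E by (meson less_le_trans)
        then have "h b' = 0"
          using h(4)[of b'] Fb' by (metis less_imp_le less_irrefl min.absorb1)
        moreover have "0 \<le> h v" if "v \<in> insert b (T - {t})" for v
        proof -
          have "0 \<le> F b' v"
            using Fb' that E b b' by (auto intro: order_trans[OF less_imp_le])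
          moreover have "0 \<le> F b v"
            using F[OF b(1)] that by auto
          ultimately show ?thesis
            using h(3)[of v] ge[of v] by (meson min.boundedI order_trans)
        qed
        moreover have "E \<le> h v" if "v \<notin> insert b' (insert b (T - {t}))" for v
        proof (cases "v = t")
          case True
          then show ?thesis using h(2) by simp
        next
          case False
          then have "E \<le> F b' v" "E \<le> F b v"
            using Fb' F[OF b(1)] that by auto
          then show ?thesis
            using h(3)[of v] ge[of v] by (meson min.boundedI order_trans)
        qed
        moreover have "supp h \<subseteq> Z"
          using h(5) g(3) Fb' by blast
        ultimately show ?thesis
          using h(1) by blast
      qed
    qed (use Suc.prems in auto)
  qed
qed

text \<open>Here terms are removed exactly, not just pushed up. The induction first frees both
  relations, that of \<open>u\<close> and that of \<open>x\<close>, from \<open>U\<close>; combining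
  them to cancel \<open>x\<close> then cannot bring \<open>U\<close> back. The entry at
  \<open>x\<close> is positive, so the entry \<open>0\<close> at \<open>u\<close> survives.\<close>

lemma clear_terms:
  assumes X: "trop_linear_space X" and U: "finite U"
    and rel: "\<And>u. u \<in> A - B \<Longrightarrow> \<exists>f\<in>X. f u = 0 \<and> (\<forall>v. 0 \<le> f v) \<and>
                (\<forall>v. v \<notin> insert u B \<longrightarrow> 0 < f v) \<and> supp f \<subseteq> A"
    and UA: "U \<subseteq> A - B" and u: "u \<in> A - B" "u \<notin> U"
  shows "\<exists>f\<in>X. f u = 0 \<and> (\<forall>v. 0 \<le> f v) \<and> (\<forall>v\<in>U. f v = TInf) \<and>
           (\<forall>v. v \<notin> insert u B \<longrightarrow> 0 < f v) \<and> supp f \<subseteq> A"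
  using U UA u
proof (induction U arbitrary: u rule: finite_induct)
  case empty
  then show ?case using rel[of u] by auto
next
  case (insert x U)
  obtain f where f: "f \<in> X" "f u = 0" "\<And>v. 0 \<le> f v" "\<And>v. v \<in> U \<Longrightarrow> f v = TInf"
     "\<And>v. v \<notin> insert u B \<Longrightarrow> 0 < f v" "supp f \<subseteq> A"
    using insert.IH[of u] insert.prems by auto
  obtain g where g: "g \<in> X" "g x = 0" "\<And>v. 0 \<le> g v" "\<And>v. v \<in> U \<Longrightarrow> g v = TInf"
     "\<And>v. v \<notin> insert x B \<Longrightarrow> 0 < g v" "supp g \<subseteq> A"
    using insert.IH[of x] insert.prems insert.hyps by auto
  show ?case
  proof (cases "f x = TInf")
    case True
    then show ?thesis using f by (intro bexI[of _ f]) auto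
  next
    case False
    obtain h where h: "h \<in> X" "h x = TInf" "\<And>v. min (f v) (f x + g v) \<le> h v"
      "\<And>v. f v \<noteq> f x + g v \<Longrightarrow> h v = min (f v) (f x + g v)" "supp h \<subseteq> supp f \<union> supp g"
      using eliminate[OF X f(1) g(1) False g(2)] by blast
    have fx: "0 < f x"
      using f(5)[of x] insert.prems by auto
    have pos: "0 < f x + g v" for v
      using add_mono[OF order_refl g(3)[of v], of "f x"] fx by (auto dest: less_le_trans)
    have "h u = 0"
      using h(4)[of u] f(2) pos[of u] by (metis less_imp_le less_irrefl min.absorb1)
    moreover have "0 \<le> h v" for v
      using order_trans[OF _ h(3)[of v], of 0] f(3)[of v] pos[of v] by simp
    moreover have "h v = TInf" if "v \<in> insert x U" for v
      using h(2) h(3)[of v] f(4)[of v] g(4)[of v] that by auto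
    moreover have "0 < h v" if "v \<notin> insert u B" for v
      using less_le_trans[OF _ h(3)[of v], of 0] f(5)[OF that] pos[of v] by simp
    ultimately show ?thesis
      using h(1,5) f(6) g(6) by blast
  qed
qed

section \<open>Initial matroids\<close>

text \<open>The restriction to the support matters only for \<open>tzero\<close>, which gets the
  empty set instead of all exponents.\<close>

definition argmin :: "tvec \<Rightarrow> (nat \<Rightarrow> int) set" where
  "argmin f = {u \<in> supp f. \<forall>v. f u \<le> f v}"

lemma argmin_nonempty:
  assumes "finite (supp f)" "f \<noteq> tzero"
  shows "argmin f \<noteq> {}"
proof -
  have ne: "supp f \<noteq> {}" using assms(2) by (auto simp: supp_def tzero_def fun_eq_iff)
  have "Min (f ` supp f) \<in> f ` supp f"
    using assms(1) ne by simp
  then obtain u where u: "u \<in> supp f" "f u = Min (f ` supp f)"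
    by force
  have "f u \<le> f v" for v
    using u assms(1) by (cases "v \<in> supp f") (auto simp: supp_def)
  with u show ?thesis by (auto simp: argmin_def)
qed

text \<open>The rank of a valuated matroid on a finite ground set does not drop on passing to an
  initial matroid; the weights are absorbed into the vectors.\<close>

lemma initial_independent_set:
  assumes X: "trop_linear_space X" and A: "finite A" and S: "S \<subseteq> A"
    and indep: "\<forall>f\<in>X. f \<noteq> tzero \<longrightarrow> \<not> supp f \<subseteq> S"
  obtains B where "B \<subseteq> A" "card S \<le> card B"
    "\<forall>f\<in>X. f \<noteq> tzero \<longrightarrow> supp f \<subseteq> A \<longrightarrow> \<not> argmin f \<subseteq> B"
proof -
  define P where "P B \<longleftrightarrow> B \<subseteq> A \<and> (\<forall>f\<in>X. f \<noteq> tzero \<longrightarrow> supp f \<subseteq> A \<longrightarrow> \<not> argmin f \<subseteq> B)" for B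
  have "P {}"
    unfolding P_def using argmin_nonempty finite_subset[OF _ A] by blast
  moreover have "\<forall>B. P B \<longrightarrow> card B < Suc (card A)"
    unfolding P_def less_Suc_eq_le using card_mono[OF A] by blast
  ultimately have "\<exists>B. P B \<and> (\<forall>B'. P B' \<longrightarrow> card B' \<le> card B)"
    by (rule ex_has_greatest_nat)
  then obtain B where B: "P B" "\<And>B'. P B' \<Longrightarrow> card B' \<le> card B"
    by blast
  have finB: "finite B" using B(1) finite_subset[OF _ A] by (simp add: P_def)
  have rel: "\<exists>f\<in>X. f u = 0 \<and> (\<forall>v. 0 \<le> f v) \<and> (\<forall>v. v \<notin> insert u B \<longrightarrow> 0 < f v) \<and> supp f \<subseteq> A"
    if u: "u \<in> A - B" for u
  proof -
    \<comment> \<open>Maximality of \<open>B\<close> gives an element whose minimal terms lie in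
      \<open>insert u B\<close>; they include \<open>u\<close> because \<open>B\<close> itself
      contains no such set. Scaling its minimum to \<open>0\<close> yields a relation for
      \<open>u\<close>.\<close>
    have "\<not> P (insert u B)"
      using B(2)[of "insert u B"] u finB by auto
    then obtain f where f: "f \<in> X" "f \<noteq> tzero" "supp f \<subseteq> A" "argmin f \<subseteq> insert u B"
      using u B(1) by (auto simp: P_def)
    have "u \<in> argmin f"
      using B(1) f by (auto simp: P_def)
    then obtain a where a: "f u = Fin a" and le: "\<And>v. f u \<le> f v"
      by (cases "f u") (auto simp: argmin_def supp_def)
    have lt: "Fin a < f v" if "v \<notin> insert u B" for v
    proof (rule ccontr)
      assume "\<not> Fin a < f v"
      then have "f v = Fin a" using le[of v] a by auto
      then have "v \<in> argmin f" using a le by (auto simp: argmin_def supp_def)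
      then show False using f(4) that by auto
    qed
    have "0 \<le> Fin (-a) + f v" for v
      using le[of v] a by (cases "f v") auto
    moreover have "0 < Fin (-a) + f v" if "v \<notin> insert u B" for v
      using lt[OF that] by (cases "f v") auto
    moreover have "supp (\<lambda>v. Fin (-a) + f v) \<subseteq> A"
      using f(3) by (auto simp: supp_def)
    ultimately show ?thesis
      using trop_linear_space_scale[OF X f(1), of "-a"] a
      by (intro bexI[of _ "\<lambda>v. Fin (-a) + f v"]) (auto simp: zero_trop_def)
  qed
  have "card S \<le> card B"
  proof (rule ccontr)
    assume "\<not> card S \<le> card B"
    then have c: "card B < card S" by simp
    \<comment> \<open>Clearing all of \<open>A - B\<close> except \<open>b\<close> leaves an exact
      relation supported in \<open>insert b B\<close>. Exchange with \<open>E = TInf\<close> would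
      then produce a nonzero element supported in \<open>S\<close>.\<close>
    have "\<exists>f\<in>X. f b = 0 \<and> (\<forall>t\<in>B. 0 \<le> f t) \<and> (\<forall>v. v \<notin> insert b B \<longrightarrow> TInf \<le> f v) \<and> supp f \<subseteq> UNIV"
      if b: "b \<in> S - B" for b
    proof -
      have "b \<in> A - B" using b S by auto
      then obtain f where f: "f \<in> X" "f b = 0" "\<forall>v. 0 \<le> f v" "\<forall>v\<in>A - B - {b}. f v = TInf" "supp f \<subseteq> A"
        using clear_terms[OF X _ rel, of "A - B - {b}" b] A by auto
      have "f v = TInf" if "v \<notin> insert b B" for v
        using f(4,5) that by (cases "v \<in> A") (auto simp: supp_def)
      with f show ?thesis by auto
    qed
    from exchange[OF X _ finite_subset[OF S A] finB c this]
    obtain f where f: "f \<in> X" "\<exists>v\<in>S. f v = 0" "\<forall>v. v \<notin> S \<longrightarrow> f v = TInf"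
      by auto
    then have "f \<noteq> tzero" "supp f \<subseteq> S"
      by (auto simp: supp_def tzero_def)
    then show False
      using indep f(1) by blast
  qed
  with B(1) that show thesis by (auto simp: P_def)
qed

section \<open>Degree and rank\<close>

text \<open>Elimination is left out, so that Boolean initial ideals qualify as soon as closure under
  sums and terms is checked, with \<open>scal = {0}\<close>. Requiring \<open>0 \<in> scal\<close>
  makes pure monomial shifts available in both cases.\<close>

definition laurent_ideal :: "real set \<Rightarrow> nat \<Rightarrow> tvec set \<Rightarrow> bool" where
  "laurent_ideal scal n J \<longleftrightarrow>
     J \<subseteq> {f. laurent_poly scal n f} \<and> tzero \<in> J \<and> 0 \<in> scal \<and>
     (\<forall>f\<in>J. \<forall>g\<in>J. padd f g \<in> J) \<and>
     (\<forall>f\<in>J. \<forall>c\<in>scal. \<forall>v\<in>expo n. mono_mult c v f \<in> J)"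

definition indep :: "nat \<Rightarrow> tvec set \<Rightarrow> (nat \<Rightarrow> int) set \<Rightarrow> bool" where
  "indep n J S \<longleftrightarrow> finite S \<and> S \<subseteq> expo n \<and> (\<forall>f\<in>J. f \<noteq> tzero \<longrightarrow> \<not> supp f \<subseteq> S)"

text \<open>A relation and not a function, since boundedness of the independent sets has to be
  proved for each ideal.\<close>

definition has_rank :: "nat \<Rightarrow> tvec set \<Rightarrow> nat \<Rightarrow> bool" where
  "has_rank n J d \<longleftrightarrow> (\<exists>S. indep n J S \<and> card S = d) \<and> (\<forall>S. indep n J S \<longrightarrow> card S \<le> d)"

definition box :: "nat \<Rightarrow> int \<Rightarrow> (nat \<Rightarrow> int) set" where
  "box n r = {u \<in> expo n. \<forall>i<n. \<bar>u i\<bar> \<le> r}"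

lemma finite_box: "finite (box n r)"
proof (rule finite_subset)
  show "box n r \<subseteq> (\<lambda>g i. if i < n then g i else 0) ` (PiE {..<n} (\<lambda>_. {-r..r}))"
  proof
    fix u assume u: "u \<in> box n r"
    have "restrict u {..<n} \<in> PiE {..<n} (\<lambda>_. {-r..r})"
      using u by (auto simp: box_def abs_le_iff)
    moreover have "u = (\<lambda>i. if i < n then restrict u {..<n} i else 0)"
      using u by (auto simp: box_def expo_def fun_eq_iff)
    ultimately show "u \<in> (\<lambda>g i. if i < n then g i else 0) ` (PiE {..<n} (\<lambda>_. {-r..r}))"
      by blast
  qed
qed (auto intro: finite_PiE)

lemma supp_eq_empty_iff: "supp f = {} \<longleftrightarrow> f = tzero"
  by (auto simp: supp_def tzero_def fun_eq_iff)

lemma indep_empty: "indep n J {}"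
  by (auto simp: indep_def supp_eq_empty_iff)

lemma supp_mono_mult: "u \<in> supp (mono_mult c v f) \<longleftrightarrow> (\<lambda>i. u i - v i) \<in> supp f"
  by (simp add: supp_def mono_mult_eq)

lemma mono_mult_eq_tzero_iff: "mono_mult c v f = tzero \<longleftrightarrow> f = tzero"
proof
  assume *: "mono_mult c v f = tzero"
  have "f u = TInf" for u
    using fun_cong[OF *, of "\<lambda>i. u i + v i"] by (simp add: mono_mult_eq tzero_def)
  then show "f = tzero" by (auto simp: tzero_def)
qed (simp add: mono_mult_eq tzero_def)

lemma indep_translate:
  assumes J: "laurent_ideal scal n J" and S: "indep n J S" and v: "v \<in> expo n"
  shows "indep n J ((\<lambda>u i. u i + v i) ` S)"
  unfolding indep_def
proof (intro conjI ballI impI)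
  show "finite ((\<lambda>u i. u i + v i) ` S)" "(\<lambda>u i. u i + v i) ` S \<subseteq> expo n"
    using S v by (auto simp: indep_def expo_def)
  fix f assume f: "f \<in> J" "f \<noteq> tzero"
  show "\<not> supp f \<subseteq> (\<lambda>u i. u i + v i) ` S"
  proof
    assume sub: "supp f \<subseteq> (\<lambda>u i. u i + v i) ` S"
    have "(\<lambda>i. - v i) \<in> expo n" using v by (auto simp: expo_def)
    then have "mono_mult 0 (\<lambda>i. - v i) f \<in> J"
      using J f by (auto simp: laurent_ideal_def)
    moreover have "supp (mono_mult 0 (\<lambda>i. - v i) f) \<subseteq> S"
    proof
      fix u assume "u \<in> supp (mono_mult 0 (\<lambda>i. - v i) f)"
      then have "(\<lambda>i. u i + v i) \<in> supp f" by (simp add: supp_mono_mult)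
      then obtain s where s: "s \<in> S" "(\<lambda>i. u i + v i) = (\<lambda>i. s i + v i)" using sub by auto
      then have "u = s" by (auto simp: fun_eq_iff)
      with s show "u \<in> S" by simp
    qed
    ultimately show False
      using S f by (auto simp: indep_def mono_mult_eq_tzero_iff)
  qed
qed

lemma card_translate: "card ((\<lambda>u i. u i + (v::nat \<Rightarrow> int) i) ` S) = card S"
proof (rule card_image)
  show "inj_on (\<lambda>u i. u i + v i) S"
    by (auto simp: inj_on_def fun_eq_iff)
qed

lemma tot_deg_upd [simp]: "tot_deg n (u(n := x)) = tot_deg n u"
  by (auto simp: tot_deg_def intro: sum.cong)

lemma tot_deg_Suc: "tot_deg (Suc n) u = tot_deg n u + u n"
  by (simp add: tot_deg_def)

section \<open>Homogenization and the Hilbert function\<close>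

text \<open>The slice of degree \<open>e\<close> with the homogenizing variable set to 1. Elements
  of the generated ideal may mix degrees; fixing \<open>e\<close> determines the exponent of that
  variable, so no two terms merge.\<close>

definition dehom :: "nat \<Rightarrow> int \<Rightarrow> tvec \<Rightarrow> tvec" where
  "dehom n e F = (\<lambda>u. if u n = 0 then F (u(n := e - tot_deg n u)) else TInf)"

text \<open>Slicing commutes with sums and with multiplication by terms, so induction over the
  generated ideal applies. A homogenized generator lives in one degree: that slice is the original
  polynomial and all others are \<open>tzero\<close>.\<close>

lemma dehom_in_ideal:
  assumes J: "laurent_ideal scal n J" and F: "F \<in> hom_ideal scal n J"
  shows "dehom n e F \<in> J"
  using F unfolding hom_ideal_def
proof (induction arbitrary: e rule: gen_ideal.induct)
  case (gen F)
  then obtain f where f: "f \<in> J" "F = homog n f" by auto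
  define D where "D = Max (tot_deg n ` supp f)"
  have f0: "f u = TInf" if "u n \<noteq> 0" for u
  proof -
    have "supp f \<subseteq> expo n" using J f by (auto simp: laurent_ideal_def laurent_poly_def)
    then show ?thesis using that by (auto simp: supp_def expo_def)
  qed
  have "dehom n e F = (if e = D then f else tzero)"
  proof (intro ext)
    fix u :: "nat \<Rightarrow> int"
    have "u(n := 0) = u" if "u n = 0" using that by (auto simp: fun_eq_iff)
    then show "dehom n e F u = (if e = D then f else tzero) u"
      using f0[of u] by (auto simp: dehom_def f(2) homog_def Let_def D_def[symmetric] tzero_def)
  qed
  then show ?case using J f by (auto simp: laurent_ideal_def)
next
  case zero
  have "dehom n e tzero = tzero" by (auto simp: dehom_def tzero_def)
  then show ?case using J by (auto simp: laurent_ideal_def)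
next
  case (add F G)
  have "dehom n e (padd F G) = padd (dehom n e F) (dehom n e G)"
    by (auto simp: dehom_def padd_def)
  then show ?case using J add.IH by (auto simp: laurent_ideal_def)
next
  case (mult F c v)
  \<comment> \<open>Multiplication by the monomial raises the degree by its total degree in all
    \<open>n + 1\<close> variables, so the slice of \<open>F\<close> is taken that much
    lower.\<close>
  define e' where "e' = e - v n - tot_deg n v"
  have "dehom n e (mono_mult c v F) = mono_mult c (v(n := 0)) (dehom n e' F)"
  proof
    fix u :: "nat \<Rightarrow> int"
    have t: "tot_deg n (\<lambda>i. u i - (v(n := 0)) i) = tot_deg n u - tot_deg n v"
      by (auto simp: tot_deg_def sum_subtractf)
    have "(\<lambda>i. (u(n := e - tot_deg n u)) i - v i) =
          (\<lambda>i. u i - (v(n := 0)) i)(n := e' - (tot_deg n u - tot_deg n v))"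
      by (auto simp: fun_eq_iff e'_def)
    then show "dehom n e (mono_mult c v F) u = mono_mult c (v(n := 0)) (dehom n e' F) u"
      by (simp add: dehom_def mono_mult_eq t del: fun_upd_apply) auto
  qed
  moreover have "v(n := 0) \<in> expo n"
    using mult.hyps by (auto simp: expo_def)
  ultimately show ?case using J mult.IH[of e'] mult.hyps by (auto simp: laurent_ideal_def)
qed

definition low_monos :: "nat \<Rightarrow> nat \<Rightarrow> (nat \<Rightarrow> int) set" where
  "low_monos n e = {u \<in> expo n. (\<forall>i. 0 \<le> u i) \<and> tot_deg n u \<le> int e}"

definition hom_mono :: "nat \<Rightarrow> nat \<Rightarrow> (nat \<Rightarrow> int) \<Rightarrow> nat \<Rightarrow> int" where
  "hom_mono n e u = u(n := int e - tot_deg n u)"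

lemma hom_mono_inj: "inj_on (hom_mono n e) (low_monos n e)"
proof (rule inj_onI)
  fix u u' assume *: "u \<in> low_monos n e" "u' \<in> low_monos n e" "hom_mono n e u = hom_mono n e u'"
  have "u i = u' i" for i
    using fun_cong[OF *(3), of i] *(1,2)
    by (cases "i = n") (auto simp: hom_mono_def low_monos_def expo_def)
  then show "u = u'" by auto
qed

lemma hom_mono_image: "hom_mono n e ` low_monos n e = deg_monos (Suc n) e"
proof (intro equalityI subsetI)
  fix v assume "v \<in> hom_mono n e ` low_monos n e"
  then show "v \<in> deg_monos (Suc n) e"
    by (auto simp: hom_mono_def low_monos_def deg_monos_def expo_def tot_deg_Suc)
next
  fix v assume v: "v \<in> deg_monos (Suc n) e"
  then have "tot_deg n v + v n = int e" "0 \<le> v n"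
    by (auto simp: deg_monos_def tot_deg_Suc)
  then have "v = hom_mono n e (v(n := 0))" "tot_deg n v \<le> int e"
    by (auto simp: hom_mono_def fun_eq_iff)
  moreover have "v(n := 0) \<in> low_monos n e"
    using v calculation(2) by (auto simp: low_monos_def deg_monos_def expo_def)
  ultimately show "v \<in> hom_mono n e ` low_monos n e" by blast
qed

lemma low_monos_subset_box: "low_monos n e \<subseteq> box n (int e)"
proof
  fix u assume u: "u \<in> low_monos n e"
  have "\<bar>u i\<bar> \<le> int e" if "i < n" for i
  proof -
    have "u i \<le> tot_deg n u"
      unfolding tot_deg_def using u that by (intro member_le_sum) (auto simp: low_monos_def)
    then show ?thesis using u by (auto simp: low_monos_def)
  qed
  then show "u \<in> box n (int e)" using u by (auto simp: box_def low_monos_def)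
qed

text \<open>An element of \<open>J\<close> supported in \<open>S\<close> is an ordinary polynomial
  of degree at most \<open>e\<close>, hence its homogenization can be padded to degree
  \<open>e\<close>. Conversely, the slice of degree \<open>e\<close> of a forbidden element of the
  homogenization is a nonzero element of \<open>J\<close> supported in \<open>S\<close>.\<close>

lemma indep_homogenization_iff:
  assumes J: "laurent_ideal scal n J" and S: "S \<subseteq> low_monos n e"
  shows "(\<forall>F\<in>hom_ideal scal n J. F \<noteq> tzero \<longrightarrow> \<not> supp F \<subseteq> hom_mono n e ` S) \<longleftrightarrow> indep n J S"
proof -
  have SE: "S \<subseteq> expo n" and fS: "finite S"
    using S finite_subset[OF order_trans[OF S low_monos_subset_box] finite_box]
    by (auto simp: low_monos_def)
  show ?thesis
  proof
    assume hom: "\<forall>F\<in>hom_ideal scal n J. F \<noteq> tzero \<longrightarrow> \<not> supp F \<subseteq> hom_mono n e ` S"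
    show "indep n J S"
      unfolding indep_def
    proof (intro conjI ballI impI notI)
      fix f assume f: "f \<in> J" "f \<noteq> tzero" "supp f \<subseteq> S"
      define D where "D = Max (tot_deg n ` supp f)"
      have lp: "laurent_poly scal n f" using f J by (auto simp: laurent_ideal_def)
      then have ord: "ord_poly scal n f"
        using f S by (auto simp: ord_poly_def low_monos_def)
      have "D \<in> tot_deg n ` supp f"
        unfolding D_def using lp f by (intro Max_in) (auto simp: laurent_poly_def supp_eq_empty_iff)
      then have De: "D \<le> int e" using f S by (auto simp: low_monos_def)
      \<comment> \<open>The padding monomial: the homogenizing variable to the power
        \<open>e - D\<close>.\<close>
      define v where "v = (\<lambda>i. if i = n then int e - D else 0)"
      define F where "F = mono_mult 0 v (homog n f)"
      have "F \<in> hom_ideal scal n J"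
        unfolding F_def hom_ideal_def
      proof (rule gen_ideal.mult)
        show "homog n f \<in> gen_ideal scal (Suc n) (homog n ` {f \<in> J. ord_poly scal n f})"
          using f ord by (intro gen_ideal.gen) auto
        show "0 \<in> scal" using J by (auto simp: laurent_ideal_def)
        show "v \<in> expo (Suc n)" "\<forall>i. 0 \<le> v i" using De by (auto simp: v_def expo_def)
      qed
      moreover have Fu: "F u = (if u n = int e - tot_deg n u then f (u(n := 0)) else TInf)" for u
      proof -
        have t: "tot_deg n (\<lambda>i. u i - v i) = tot_deg n u"
          by (auto simp: tot_deg_def v_def intro: sum.cong)
        have "(\<lambda>i. u i - v i)(n := 0) = u(n := 0)"
          by (auto simp: v_def fun_eq_iff)
        moreover have "v n = int e - D" by (simp add: v_def)
        ultimately show ?thesis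
          by (auto simp: F_def mono_mult_eq homog_def Let_def D_def[symmetric] t zero_trop_def[symmetric])
      qed
      have "supp F \<subseteq> hom_mono n e ` S"
      proof
        fix u assume "u \<in> supp F"
        then have u: "u n = int e - tot_deg n u" "u(n := 0) \<in> supp f"
          by (auto simp: supp_def Fu split: if_splits)
        then have "u = hom_mono n e (u(n := 0))" by (auto simp: hom_mono_def fun_eq_iff)
        with u f(3) show "u \<in> hom_mono n e ` S" by blast
      qed
      moreover have "F \<noteq> tzero"
      proof -
        obtain u where u: "u \<in> supp f" using f by (auto simp: supp_eq_empty_iff[symmetric])
        have "u n = 0" using u f SE by (auto simp: expo_def)
        then have "(hom_mono n e u)(n := 0) = u"
          by (auto simp: hom_mono_def fun_eq_iff)
        then have "F (hom_mono n e u) = f u"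
          by (subst Fu) (simp add: hom_mono_def)
        then show ?thesis using u by (auto simp: supp_def tzero_def)
      qed
      ultimately show False using hom by blast
    qed (use SE fS in auto)
  next
    assume ind: "indep n J S"
    show "\<forall>F\<in>hom_ideal scal n J. F \<noteq> tzero \<longrightarrow> \<not> supp F \<subseteq> hom_mono n e ` S"
    proof (intro ballI impI notI)
      fix F assume F: "F \<in> hom_ideal scal n J" "F \<noteq> tzero" "supp F \<subseteq> hom_mono n e ` S"
      have "dehom n (int e) F \<in> J" using dehom_in_ideal[OF J F(1)] .
      moreover have "supp (dehom n (int e) F) \<subseteq> S"
      proof
        fix u assume "u \<in> supp (dehom n (int e) F)"
        then have u: "u n = 0" "hom_mono n e u \<in> supp F"
          by (auto simp: supp_def dehom_def hom_mono_def split: if_splits)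
        then obtain s where s: "s \<in> S" "hom_mono n e u = hom_mono n e s" using F(3) by auto
        have "u i = s i" for i
          using fun_cong[OF s(2), of i] u s(1) SE by (cases "i = n") (auto simp: hom_mono_def expo_def)
        then have "u = s" by auto
        with s show "u \<in> S" by simp
      qed
      moreover have "dehom n (int e) F \<noteq> tzero"
      proof -
        obtain v where v: "v \<in> supp F" using F by (auto simp: supp_eq_empty_iff[symmetric])
        then obtain s where s: "s \<in> S" "v = hom_mono n e s" using F(3) by auto
        have "s n = 0" using s SE by (auto simp: expo_def)
        then have "dehom n (int e) F s = F v" by (simp add: dehom_def s hom_mono_def)
        then show ?thesis using v by (auto simp: supp_def tzero_def)
      qed
      ultimately show False using ind by (auto simp: indep_def)
    qed
  qed
qed

lemma hilbert_fun_eq: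
  assumes J: "laurent_ideal scal n J"
  shows "hilbert_fun (Suc n) (hom_ideal scal n J) e =
           Max {card S | S. S \<subseteq> low_monos n e \<and> indep n J S}"
proof -
  have "{card S | S. S \<subseteq> deg_monos (Suc n) e \<and>
          (\<forall>f\<in>hom_ideal scal n J. f \<noteq> tzero \<longrightarrow> \<not> supp f \<subseteq> S)} =
        {card S | S. S \<subseteq> low_monos n e \<and> indep n J S}" (is "?L = ?R")
  proof (intro equalityI subsetI)
    fix k assume "k \<in> ?L"
    then obtain S where S: "k = card S" "S \<subseteq> hom_mono n e ` low_monos n e"
      "\<forall>f\<in>hom_ideal scal n J. f \<noteq> tzero \<longrightarrow> \<not> supp f \<subseteq> S"
      by (auto simp: hom_mono_image)
    then obtain T where T: "T \<subseteq> low_monos n e" "S = hom_mono n e ` T"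
      by (auto simp: subset_image_iff)
    have "indep n J T" using S(3) indep_homogenization_iff[OF J T(1)] T(2) by simp
    moreover have "card S = card T"
      using T hom_mono_inj by (metis card_image inj_on_subset)
    ultimately show "k \<in> ?R" using S T by auto
  next
    fix k assume "k \<in> ?R"
    then obtain T where T: "k = card T" "T \<subseteq> low_monos n e" "indep n J T" by auto
    have "card (hom_mono n e ` T) = card T"
      using T hom_mono_inj by (metis card_image inj_on_subset)
    moreover have "hom_mono n e ` T \<subseteq> deg_monos (Suc n) e"
      using T hom_mono_image by blast
    ultimately show "k \<in> ?L"
      using T indep_homogenization_iff[OF J T(2)] by (intro CollectI exI[of _ "hom_mono n e ` T"]) simp
  qed
  then show ?thesis by (simp add: hilbert_fun_def)
qed

lemma finite_low_indep: "finite {card S | S. S \<subseteq> low_monos n e \<and> indep n J S}"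
proof -
  have "finite (low_monos n e)" using finite_subset[OF low_monos_subset_box finite_box] .
  then have "finite (card ` Pow (low_monos n e))" by simp
  then show ?thesis by (rule rev_finite_subset) auto
qed

lemma hilbert_attained:
  assumes J: "laurent_ideal scal n J"
  shows "\<exists>S. indep n J S \<and> card S = hilbert_fun (Suc n) (hom_ideal scal n J) e"
proof -
  have "Max {card S | S. S \<subseteq> low_monos n e \<and> indep n J S} \<in> {card S | S. S \<subseteq> low_monos n e \<and> indep n J S}"
    using finite_low_indep indep_empty by (intro Max_in) auto
  then show ?thesis unfolding hilbert_fun_eq[OF J] by force
qed

text \<open>Any finite set of Laurent monomials can be multiplied into the nonnegative orthant
  without losing independence, and there it has bounded degree.\<close>

lemma eventually_card_le_hilbert:
  assumes J: "laurent_ideal scal n J" and S: "indep n J S"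
  shows "\<forall>\<^sub>F e in sequentially. card S \<le> hilbert_fun (Suc n) (hom_ideal scal n J) e"
proof -
  have fS: "finite S" and SE: "S \<subseteq> expo n" using S by (auto simp: indep_def)
  \<comment> \<open>A crude bound for all coordinates occurring in \<open>S\<close>: after adding
    \<open>c\<close> they lie between \<open>0\<close> and \<open>2 * c\<close>, so the degree is at
    most \<open>2 * c * n\<close>.\<close>
  define c where "c = (\<Sum>u\<in>S. \<Sum>i<n. \<bar>u i\<bar>)"
  have c: "\<bar>u i\<bar> \<le> c" if "u \<in> S" "i < n" for u i
  proof -
    have "\<bar>u i\<bar> \<le> (\<Sum>i<n. \<bar>u i\<bar>)" using that by (intro member_le_sum) auto
    also have "\<dots> \<le> c" unfolding c_def using that fS
      by (intro member_le_sum[of u S "\<lambda>u. \<Sum>i<n. \<bar>u i\<bar>"]) (auto intro: sum_nonneg)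
    finally show ?thesis .
  qed
  define v where "v = (\<lambda>i. if i < n then c else 0)"
  let ?S = "(\<lambda>u i. u i + v i) ` S"
  have v: "v \<in> expo n" by (auto simp: v_def expo_def)
  have low: "?S \<subseteq> low_monos n e" if e: "int e \<ge> 2 * c * int n" for e
  proof clarify
    fix u assume u: "u \<in> S"
    have "0 \<le> u i + v i" for i
      using c[OF u, of i] u SE by (cases "i < n") (auto simp: v_def expo_def)
    moreover have "tot_deg n (\<lambda>i. u i + v i) \<le> (\<Sum>i<n. 2 * c)"
      unfolding tot_deg_def using c[OF u] by (intro sum_mono) (auto simp: v_def dest!: abs_le_D1)
    ultimately show "(\<lambda>i. u i + v i) \<in> low_monos n e"
      using u SE v e by (auto simp: low_monos_def expo_def algebra_simps)
  qed
  have "card S \<le> hilbert_fun (Suc n) (hom_ideal scal n J) e" if e: "e \<ge> nat (2 * c * int n)" for e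
    unfolding hilbert_fun_eq[OF J]
  proof (rule Max_ge[OF finite_low_indep])
    have "card S = card ?S" by (simp add: card_translate)
    then show "card S \<in> {card S | S. S \<subseteq> low_monos n e \<and> indep n J S}"
      using low[of e] e indep_translate[OF J S v] by (intro CollectI exI[of _ ?S]) auto
  qed
  then show ?thesis by (auto simp: eventually_sequentially)
qed

lemma hilbert_poly_unique:
  assumes "is_hilbert_poly m J p" "is_hilbert_poly m J q"
  shows "p = q"
proof (rule ccontr)
  assume "p \<noteq> q"
  then have fin: "finite {x. poly (p - q) x = 0}" by (intro poly_roots_finite) auto
  obtain a b where "\<forall>e\<ge>a. real (hilbert_fun m J e) = poly p (real e)"
    "\<forall>e\<ge>b. real (hilbert_fun m J e) = poly q (real e)"
    using assms by (auto simp: is_hilbert_poly_def)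
  then have "poly (p - q) (real e) = 0" if "e \<ge> max a b" for e
    using that by (metis max.bounded_iff poly_diff right_minus_eq)
  then have "real ` {max a b..} \<subseteq> {x. poly (p - q) x = 0}" by auto
  moreover have "infinite (real ` {max a b..})"
    by (subst finite_image_iff) (auto simp: infinite_Ici)
  ultimately show False using fin finite_subset by blast
qed

lemma laurent_hpoly_eq:
  assumes "is_hilbert_poly (Suc n) (hom_ideal scal n J) p"
  shows "laurent_hpoly scal n J = p"
  unfolding laurent_hpoly_def using assms by (blast intro: the_equality hilbert_poly_unique)

text \<open>The Hilbert function never exceeds the rank and eventually reaches it, so it is
  eventually constant. With \<open>scal = {0}\<close> the same statement evaluates
  multiplicities.\<close>

lemma tdeg_eq_rank:
  assumes J: "laurent_ideal scal n J" and d: "has_rank n J d"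
  shows "tdeg scal n J = real d"
proof -
  obtain S where S: "indep n J S" "card S = d" using d by (auto simp: has_rank_def)
  have "hilbert_fun (Suc n) (hom_ideal scal n J) e \<le> d" for e
    using hilbert_attained[OF J, of e] d by (auto simp: has_rank_def)
  then have "\<forall>\<^sub>F e in sequentially. hilbert_fun (Suc n) (hom_ideal scal n J) e = d"
    using eventually_card_le_hilbert[OF J S(1)] S(2) by (auto elim!: eventually_mono intro: antisym)
  then have "is_hilbert_poly (Suc n) (hom_ideal scal n J) [:real d:]"
    by (auto simp: is_hilbert_poly_def eventually_sequentially)
  then show ?thesis by (simp add: tdeg_def laurent_hpoly_eq)
qed

text \<open>Dimension zero enters the proof here: the eventual constant value bounds every
  independent set, because each one is eventually counted by the Hilbert function.\<close>

lemma zero_dimensional_has_rank: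
  assumes J: "laurent_ideal scal n J" and z: "zero_dimensional scal n J"
  obtains d where "has_rank n J d"
proof -
  obtain p where p: "is_hilbert_poly (Suc n) (hom_ideal scal n J) p"
    using z by (auto simp: zero_dimensional_def)
  have "degree p = 0"
    using z laurent_hpoly_eq[OF p] by (simp add: zero_dimensional_def tdim_def)
  then obtain a where a: "p = [:a:]" by (auto elim: degree_eq_zeroE)
  obtain e0 where e0: "\<And>e. e \<ge> e0 \<Longrightarrow> real (hilbert_fun (Suc n) (hom_ideal scal n J) e) = a"
    using p a by (auto simp: is_hilbert_poly_def)
  define d where "d = hilbert_fun (Suc n) (hom_ideal scal n J) e0"
  have const: "hilbert_fun (Suc n) (hom_ideal scal n J) e = d" if "e \<ge> e0" for e
    using e0[OF that] e0[of e0] by (simp add: d_def)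
  have "card S \<le> d" if S: "indep n J S" for S
  proof -
    obtain e1 where "\<And>e. e \<ge> e1 \<Longrightarrow> card S \<le> hilbert_fun (Suc n) (hom_ideal scal n J) e"
      using eventually_card_le_hilbert[OF J S] by (auto simp: eventually_sequentially)
    then show ?thesis using const[of "max e0 e1"] by (metis max.cobounded1 max.cobounded2)
  qed
  then have "has_rank n J d"
    using hilbert_attained[OF J, of e0] by (auto simp: has_rank_def d_def)
  then show thesis by (rule that)
qed

section \<open>Initial ideals and the upper bound\<close>

text \<open>Adding the weight to the coefficients turns a weighted initial support into a plain
  \<open>argmin\<close>, for arbitrary weights \<open>h\<close>.\<close>

definition twist :: "((nat \<Rightarrow> int) \<Rightarrow> real) \<Rightarrow> tvec \<Rightarrow> tvec" where
  "twist h f = (\<lambda>u. f u + Fin (h u))"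

lemma supp_twist [simp]: "supp (twist h f) = supp f"
  by (simp add: supp_def twist_def)

lemma twist_eq_tzero_iff [simp]: "twist h f = tzero \<longleftrightarrow> f = tzero"
  by (auto simp: supp_eq_empty_iff[symmetric])

lemma trop_linear_space_twist:
  assumes X: "trop_linear_space X"
  shows "trop_linear_space (twist h ` X)"
  unfolding trop_linear_space_def elimination_axiom_def
proof (intro conjI ballI allI impI)
  fix F c assume "F \<in> twist h ` X"
  then obtain f where f: "f \<in> X" "F = twist h f" by auto
  then have "(\<lambda>u. Fin c + F u) = twist h (\<lambda>u. Fin c + f u)"
    by (auto simp: twist_def add.assoc)
  then show "(\<lambda>u. Fin c + F u) \<in> twist h ` X"
    using trop_linear_space_scale[OF X f(1), of c] by auto
next
  fix F G u assume FG: "F \<in> twist h ` X" "G \<in> twist h ` X" "F u = G u \<and> F u \<noteq> TInf"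
  then obtain f g where f: "f \<in> X" "F = twist h f" and g: "g \<in> X" "G = twist h g" by auto
  have fg: "f u = g u" "f u \<noteq> TInf"
    using FG(3) by (cases "f u"; cases "g u"; auto simp: f g twist_def)+
  have "elimination_axiom X" using X by (simp add: trop_linear_space_def)
  from this[unfolded elimination_axiom_def, THEN bspec, OF f(1), THEN bspec, OF g(1), THEN spec, of u]
  obtain k where k: "k \<in> X" "k u = TInf"
    "\<And>v. tle (tmin (f v) (g v)) (k v) \<and> (f v \<noteq> g v \<longrightarrow> k v = tmin (f v) (g v))"
    using fg by auto
  show "\<exists>K\<in>twist h ` X. K u = TInf \<and>
          (\<forall>v. tle (tmin (F v) (G v)) (K v) \<and> (F v \<noteq> G v \<longrightarrow> K v = tmin (F v) (G v)))"
  proof (rule bexI[of _ "twist h k"], intro conjI allI)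
    show "twist h k u = TInf" using k(2) by (simp add: twist_def)
    fix v
    show "tle (tmin (F v) (G v)) (twist h k v)"
      using k(3)[of v] by (cases "f v"; cases "g v"; cases "k v")
        (auto simp: f g twist_def tmin_eq_min less_eq_trop_def[symmetric] min_def split: if_splits)
    show "F v \<noteq> G v \<longrightarrow> twist h k v = tmin (F v) (G v)"
      using k(3)[of v] by (cases "f v"; cases "g v"; cases "k v")
        (auto simp: f g twist_def tmin_eq_min less_eq_trop_def[symmetric] min_def split: if_splits)
  qed (use k in auto)
qed

lemma dotp_diff: "dotp n (\<lambda>i. u i - v i) w = dotp n u w - dotp n v w"
  by (simp add: dotp_def left_diff_distrib sum_subtractf)

lemma min_terms_eq_argmin:
  assumes "finite (supp f)" "f \<noteq> tzero"
  shows "min_terms n f w = argmin (twist (\<lambda>u. dotp n u w) f)"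
proof -
  let ?F = "twist (\<lambda>u. dotp n u w) f"
  let ?V = "{c + dotp n u w | u c. f u = Fin c}"
  have "?V = (\<lambda>u. (case f u of Fin c \<Rightarrow> c | TInf \<Rightarrow> 0) + dotp n u w) ` supp f"
  proof (intro equalityI subsetI)
    fix x assume "x \<in> ?V"
    then obtain u c where "f u = Fin c" "x = c + dotp n u w" by auto
    then show "x \<in> (\<lambda>u. (case f u of Fin c \<Rightarrow> c | TInf \<Rightarrow> 0) + dotp n u w) ` supp f"
      by (intro image_eqI[of _ _ u]) (auto simp: supp_def)
  next
    fix x assume "x \<in> (\<lambda>u. (case f u of Fin c \<Rightarrow> c | TInf \<Rightarrow> 0) + dotp n u w) ` supp f"
    then show "x \<in> ?V" by (auto simp: supp_def split: trop.splits) blast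
  qed
  then have fin: "finite ?V" and ne: "?V \<noteq> {}"
    using assms by (simp_all add: supp_eq_empty_iff)
  have "u \<in> min_terms n f w \<longleftrightarrow> u \<in> argmin ?F" for u
  proof
    assume "u \<in> min_terms n f w"
    then obtain c where c: "f u = Fin c" "c + dotp n u w = Min ?V"
      by (auto simp: min_terms_def teval_def)
    have "?F u \<le> ?F v" for v
    proof (cases "f v")
      case (Fin b)
      then have "b + dotp n v w \<in> ?V" by auto
      then have "Min ?V \<le> b + dotp n v w" using fin by (intro Min_le)
      then show ?thesis using c Fin by (simp add: twist_def)
    qed (simp add: twist_def)
    then show "u \<in> argmin ?F" using c by (simp add: argmin_def) (simp add: supp_def)
  next
    assume u: "u \<in> argmin ?F"
    then obtain c where c: "f u = Fin c" by (cases "f u") (auto simp: argmin_def supp_def twist_def)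
    have "Min ?V = c + dotp n u w"
    proof (rule Min_eqI[OF fin])
      fix y assume "y \<in> ?V"
      then obtain v b where v: "f v = Fin b" "y = b + dotp n v w" by auto
      have "?F u \<le> ?F v" using u by (simp add: argmin_def)
      then show "c + dotp n u w \<le> y" using c v by (simp add: twist_def)
    qed (use c in auto)
    then show "u \<in> min_terms n f w" using c by (auto simp: min_terms_def teval_def)
  qed
  then show ?thesis by blast
qed

lemma argmin_tzero: "argmin (twist h tzero) = {}"
  by (simp add: argmin_def) (simp add: supp_def tzero_def)

lemma init_form_eq:
  assumes "finite (supp f)"
  shows "init_form n w f = (\<lambda>u. if u \<in> argmin (twist (\<lambda>u. dotp n u w) f) then Fin 0 else TInf)"
proof (cases "f = tzero")
  case True
  then show ?thesis by (auto simp: init_form_def argmin_tzero)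
next
  case False
  then show ?thesis using min_terms_eq_argmin[OF assms False] by (auto simp: init_form_def)
qed

lemma supp_init_form:
  assumes "finite (supp f)"
  shows "supp (init_form n w f) = argmin (twist (\<lambda>u. dotp n u w) f)"
  by (auto simp: init_form_eq[OF assms] supp_def)

lemma argmin_translate:
  assumes "\<And>u. F' u = Fin c + F (\<lambda>i. u i - v i)"
  shows "u \<in> argmin F' \<longleftrightarrow> (\<lambda>i. u i - v i) \<in> argmin F"
proof -
  have "(\<forall>x. Fin c + F (\<lambda>i. u i - v i) \<le> Fin c + F (\<lambda>i. x i - v i)) \<longleftrightarrow>
        (\<forall>x. F (\<lambda>i. u i - v i) \<le> F x)"
  proof
    assume *: "\<forall>x. Fin c + F (\<lambda>i. u i - v i) \<le> Fin c + F (\<lambda>i. x i - v i)"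
    show "\<forall>x. F (\<lambda>i. u i - v i) \<le> F x"
    proof
      fix x
      show "F (\<lambda>i. u i - v i) \<le> F x"
        using *[rule_format, of "\<lambda>i. x i + v i"]
        by (cases "F (\<lambda>i. u i - v i)"; cases "F x") auto
    qed
  qed (auto intro: add_left_mono)
  then show ?thesis
    by (simp add: argmin_def supp_def assms)
qed

lemma laurent_ideal_finite: "laurent_ideal scal n J \<Longrightarrow> f \<in> J \<Longrightarrow> finite (supp f)"
  by (auto simp: laurent_ideal_def laurent_poly_def)

lemma laurent_ideal_expo: "laurent_ideal scal n J \<Longrightarrow> f \<in> J \<Longrightarrow> supp f \<subseteq> expo n"
  by (auto simp: laurent_ideal_def laurent_poly_def)

lemma laurent_ideal_mult:
  "laurent_ideal scal n J \<Longrightarrow> f \<in> J \<Longrightarrow> c \<in> scal \<Longrightarrow> v \<in> expo n \<Longrightarrow> mono_mult c v f \<in> J"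
  by (auto simp: laurent_ideal_def)

lemma argmin_twist_mult:
  "u \<in> argmin (twist (\<lambda>u. dotp n u w) (mono_mult c v f)) \<longleftrightarrow>
     (\<lambda>i. u i - v i) \<in> argmin (twist (\<lambda>u. dotp n u w) f)"
proof (rule argmin_translate)
  fix u
  show "twist (\<lambda>u. dotp n u w) (mono_mult c v f) u =
          Fin (c + dotp n v w) + twist (\<lambda>u. dotp n u w) f (\<lambda>i. u i - v i)"
    by (cases "f (\<lambda>i. u i - v i)") (simp_all add: twist_def mono_mult_eq dotp_diff)
qed

lemma argmin_min:
  assumes "a \<in> argmin F" "b \<in> argmin G" "F a = G b"
  shows "argmin (\<lambda>u. min (F u) (G u)) = argmin F \<union> argmin G"
proof -
  obtain m where m: "F a = Fin m" "G b = Fin m"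
    using assms(2,3) by (cases "G b") (auto simp: argmin_def supp_def)
  have FG: "Fin m \<le> F v" "Fin m \<le> G v" for v
    using assms m by (auto simp: argmin_def)
  have F: "u \<in> argmin F \<longleftrightarrow> F u = Fin m" and G: "u \<in> argmin G \<longleftrightarrow> G u = Fin m" for u
    using FG m by (auto simp: argmin_def supp_def intro: antisym) (metis antisym)+
  have "u \<in> argmin (\<lambda>u. min (F u) (G u)) \<longleftrightarrow> min (F u) (G u) = Fin m" for u
  proof
    assume "u \<in> argmin (\<lambda>u. min (F u) (G u))"
    then have "min (F u) (G u) \<le> min (F a) (G a)" by (simp add: argmin_def)
    also have "\<dots> \<le> Fin m" using m by simp
    finally show "min (F u) (G u) = Fin m" using FG[of u] by (auto intro!: antisym)
  next
    assume "min (F u) (G u) = Fin m"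
    then show "u \<in> argmin (\<lambda>u. min (F u) (G u))" using FG by (simp add: argmin_def supp_def)
  qed
  moreover have "min (F u) (G u) = Fin m \<longleftrightarrow> F u = Fin m \<or> G u = Fin m" for u
    using FG[of u] by (auto simp: min_def)
  ultimately show ?thesis using F G by blast
qed

lemma laurent_ideal_init:
  assumes I: "laurent_ideal UNIV n I"
  shows "laurent_ideal {0} n (init_ideal n w I)"
  unfolding laurent_ideal_def
proof (intro conjI ballI)
  let ?h = "\<lambda>u. dotp n u w"
  note fin = laurent_ideal_finite[OF I]
  show "init_ideal n w I \<subseteq> {f. laurent_poly {0} n f}"
  proof
    fix F assume "F \<in> init_ideal n w I"
    then obtain f where f: "f \<in> I" "F = init_form n w f" by (auto simp: init_ideal_def)
    have "supp F \<subseteq> supp f"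
      using f supp_init_form[OF fin[OF f(1)]] by (auto simp: argmin_def)
    moreover have "coeffs_in {0} F"
      by (auto simp: f coeffs_in_def init_form_def)
    ultimately show "F \<in> {f. laurent_poly {0} n f}"
      using fin[OF f(1)] laurent_ideal_expo[OF I f(1)] finite_subset
      by (auto simp: laurent_poly_def)
  qed
  have t: "tzero \<in> I" using I by (auto simp: laurent_ideal_def)
  then have "init_form n w tzero \<in> init_ideal n w I" by (auto simp: init_ideal_def)
  then show "tzero \<in> init_ideal n w I" by (simp add: init_form_def tzero_def)
  show "(0::real) \<in> {0}" by simp
  show "mono_mult c v F \<in> init_ideal n w I" if F: "F \<in> init_ideal n w I" "c \<in> {0}" "v \<in> expo n" for F c v
  proof -
    obtain f where f: "f \<in> I" "F = init_form n w f" using F by (auto simp: init_ideal_def)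
    have m: "mono_mult 0 v f \<in> I" using laurent_ideal_mult[OF I f(1) _ F(3)] by simp
    have "mono_mult c v F = init_form n w (mono_mult 0 v f)"
      using F(2) unfolding f(2) init_form_eq[OF fin[OF f(1)]] init_form_eq[OF fin[OF m]] argmin_twist_mult
      by (auto simp: mono_mult_eq)
    then show ?thesis using m by (auto simp: init_ideal_def)
  qed
  show "padd F G \<in> init_ideal n w I" if FG: "F \<in> init_ideal n w I" "G \<in> init_ideal n w I" for F G
  proof -
    obtain f g where f: "f \<in> I" "F = init_form n w f" and g: "g \<in> I" "G = init_form n w g"
      using FG by (auto simp: init_ideal_def)
    show ?thesis
    proof (cases "f = tzero \<or> g = tzero")
      case True
      then have "F = tzero \<or> G = tzero" by (auto simp: f g init_form_def tzero_def)
      then have "padd F G = F \<or> padd F G = G" by (auto simp: padd_eq tzero_def min_def)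
      then show ?thesis using FG by auto
    next
      case False
      obtain a b where ab: "a \<in> argmin (twist ?h f)" "b \<in> argmin (twist ?h g)"
        using argmin_nonempty[of "twist ?h f"] argmin_nonempty[of "twist ?h g"] False fin f g by auto
      obtain x y where xy: "twist ?h f a = Fin x" "twist ?h g b = Fin y"
        using ab by (cases "twist ?h f a"; cases "twist ?h g b") (auto simp: argmin_def supp_def twist_def)
      \<comment> \<open>The scalar \<open>x - y\<close> brings both minima to the same level; only
        then is the initial form of the sum the sum of the initial forms.\<close>
      define g' where "g' = mono_mult (x - y) (\<lambda>i. 0) g"
      have g'I: "g' \<in> I" unfolding g'_def using laurent_ideal_mult[OF I g(1)] by (auto simp: expo_def)
      have g'tw: "twist ?h g' u = Fin (x - y) + twist ?h g u" for u
        by (simp add: g'_def twist_def mono_mult_eq add.assoc)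
      have arg: "argmin (twist ?h g') = argmin (twist ?h g)"
        using argmin_twist_mult[of _ n w "x - y" "\<lambda>i. 0" g] by (auto simp: g'_def)
      have pI: "padd f g' \<in> I" using I f g'I by (auto simp: laurent_ideal_def)
      have "twist ?h (padd f g') = (\<lambda>u. min (twist ?h f u) (twist ?h g' u))"
      proof
        fix u show "twist ?h (padd f g') u = min (twist ?h f u) (twist ?h g' u)"
          by (cases "f u"; cases "g' u") (auto simp: twist_def padd_eq min_def)
      qed
      then have "argmin (twist ?h (padd f g')) = argmin (twist ?h f) \<union> argmin (twist ?h g)"
        using argmin_min[of a "twist ?h f" b "twist ?h g'"] ab arg xy g'tw by simp
      then have "padd F G = init_form n w (padd f g')"
        unfolding f(2) g(2) init_form_eq[OF fin[OF f(1)]] init_form_eq[OF fin[OF g(1)]]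
          init_form_eq[OF fin[OF pI]] by (auto simp: padd_eq)
      then show ?thesis using pI by (auto simp: init_ideal_def)
    qed
  qed
qed

text \<open>Independence over the Boolean initial ideal is read off from minimal terms of elements
  of \<open>I\<close>, so elimination can be carried out in \<open>I\<close> itself.\<close>

lemma indep_init_iff:
  assumes I: "laurent_ideal UNIV n I"
  shows "indep n (init_ideal n w I) S \<longleftrightarrow> finite S \<and> S \<subseteq> expo n \<and>
           (\<forall>f\<in>I. f \<noteq> tzero \<longrightarrow> \<not> argmin (twist (\<lambda>u. dotp n u w) f) \<subseteq> S)"
proof -
  have "init_form n w f \<noteq> tzero \<longleftrightarrow> f \<noteq> tzero" if "f \<in> I" for f
    using supp_init_form[OF laurent_ideal_finite[OF I that], of n w] argmin_tzero
      argmin_nonempty[of "twist (\<lambda>u. dotp n u w) f"] laurent_ideal_finite[OF I that]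
    by (metis supp_eq_empty_iff supp_twist twist_eq_tzero_iff)
  then show ?thesis
    using supp_init_form[OF laurent_ideal_finite[OF I]]
    by (auto simp: indep_def init_ideal_def)
qed

section \<open>Translating independent sets apart\<close>

definition far_shift :: "nat \<Rightarrow> nat \<Rightarrow> (nat \<Rightarrow> real) \<Rightarrow> nat \<Rightarrow> int" where
  "far_shift n K w = (\<lambda>i. if i < n then \<lfloor>- real K * w i\<rfloor> else 0)"

text \<open>The shifts \<open>-K w\<close> are the gradients of \<open>- K |w|\<^sup>2 / 2\<close>; strict convexity of the square
  makes each shifted cluster lightest at its own point \<open>w\<close>.\<close>

lemma eventually_separated:
  assumes w: "w \<in> rvec n" "w' \<in> rvec n" "w \<noteq> w'"
  shows "\<forall>\<^sub>F K in sequentially.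
    dotp n (\<lambda>i. s i + far_shift n K w i) w + real K / 2 * (\<Sum>i<n. (w i)\<^sup>2) <
    dotp n (\<lambda>i. s i + far_shift n K w i) w' + real K / 2 * (\<Sum>i<n. (w' i)\<^sup>2)"
proof -
  \<comment> \<open>The part of the difference that does not grow with \<open>K\<close>: the
    contribution of \<open>s\<close>, plus the rounding error of \<open>far_shift\<close>, which is
    at most 1 per coordinate.\<close>
  define C where "C = (\<Sum>i<n. of_int (s i) * (w i - w' i) + \<bar>w i - w' i\<bar>)"
  define Q where "Q = (\<Sum>i<n. (w i - w' i)\<^sup>2)"
  obtain j where j: "w j \<noteq> w' j" using w(3) by auto
  then have "j < n" using w(1,2) by (metis (mono_tags, lifting) mem_Collect_eq not_le rvec_def)
  then have Q: "0 < Q" unfolding Q_def using j by (intro sum_pos2[of _ j]) auto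
  have bound: "dotp n (\<lambda>i. s i + far_shift n K w i) w + real K / 2 * (\<Sum>i<n. (w i)\<^sup>2) -
    (dotp n (\<lambda>i. s i + far_shift n K w i) w' + real K / 2 * (\<Sum>i<n. (w' i)\<^sup>2)) \<le> C - real K / 2 * Q" for K
  proof -
    have "(of_int (s i + far_shift n K w i) * w i + real K / 2 * (w i)\<^sup>2) -
       (of_int (s i + far_shift n K w i) * w' i + real K / 2 * (w' i)\<^sup>2) \<le>
       of_int (s i) * (w i - w' i) + \<bar>w i - w' i\<bar> - real K / 2 * (w i - w' i)\<^sup>2" if "i < n" for i
    proof -
      define x where "x = w i - w' i"
      define r where "r = of_int (far_shift n K w i) + real K * w i"
      have "\<bar>r\<bar> \<le> 1" using that by (simp add: r_def far_shift_def) linarith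
      then have "\<bar>r * x\<bar> \<le> \<bar>x\<bar>" by (simp add: abs_mult mult_left_le_one_le)
      then have "r * x \<le> \<bar>x\<bar>" by linarith
      moreover have "(of_int (s i + far_shift n K w i) * w i + real K / 2 * (w i)\<^sup>2) -
       (of_int (s i + far_shift n K w i) * w' i + real K / 2 * (w' i)\<^sup>2) =
        of_int (s i) * x + r * x - real K / 2 * x\<^sup>2"
        by (simp add: r_def x_def power2_eq_square field_simps)
      ultimately show ?thesis by (simp add: x_def)
    qed
    then have "(\<Sum>i<n. (of_int (s i + far_shift n K w i) * w i + real K / 2 * (w i)\<^sup>2) -
       (of_int (s i + far_shift n K w i) * w' i + real K / 2 * (w' i)\<^sup>2)) \<le>
       (\<Sum>i<n. of_int (s i) * (w i - w' i) + \<bar>w i - w' i\<bar> - real K / 2 * (w i - w' i)\<^sup>2)"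
      by (intro sum_mono) auto
    then show ?thesis
      by (simp add: dotp_def C_def Q_def sum.distrib sum_subtractf sum_distrib_left)
  qed
  have "\<forall>\<^sub>F K in sequentially. 2 * C / Q < real K"
    using filterlim_real_sequentially by (rule filterlim_at_top_dense[THEN iffD1, rule_format])
  then show ?thesis
  proof eventually_elim
    case (elim K)
    then have "C - real K / 2 * Q < 0" using Q by (simp add: field_simps)
    then show ?case using bound[of K] by linarith
  qed
qed

text \<open>Suppose \<open>f\<close> is supported in the union. Among pairs of a point
  \<open>w\<close> and a term \<open>u\<close> in its cluster, choose one minimizing coefficient
  plus \<open>dotp n u w + q K w\<close>. Independence at \<open>w\<close> forces a
  \<open>w\<close>-minimal term \<open>v\<close> outside the cluster of \<open>w\<close>; charging
  \<open>v\<close> to the cluster \<open>w'\<close> that contains it makes the value strictly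
  smaller.\<close>

lemma indep_disjoint_union:
  assumes I: "laurent_ideal UNIV n I" and W: "finite W" "W \<subseteq> rvec n"
    and S: "\<And>w. w \<in> W \<Longrightarrow> indep n (init_ideal n w I) (S w)"
  shows "\<exists>T. indep n I T \<and> card T = (\<Sum>w\<in>W. card (S w))"
proof -
  have fS: "finite (S w)" if "w \<in> W" for w using S[OF that] by (auto simp: indep_def)
  define q where "q K w = real K / 2 * (\<Sum>i<n. (w i)\<^sup>2)" for K and w :: "nat \<Rightarrow> real"
  have "\<forall>\<^sub>F K in sequentially. \<forall>w\<in>W. \<forall>w'\<in>W - {w}. \<forall>s\<in>S w.
    dotp n (\<lambda>i. s i + far_shift n K w i) w + q K w < dotp n (\<lambda>i. s i + far_shift n K w i) w' + q K w'"
    unfolding q_def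
    by (intro eventually_ball_finite ballI eventually_separated) (use W fS in auto)
  then have "\<exists>K. \<forall>w\<in>W. \<forall>w'\<in>W - {w}. \<forall>s\<in>S w.
    dotp n (\<lambda>i. s i + far_shift n K w i) w + q K w < dotp n (\<lambda>i. s i + far_shift n K w i) w' + q K w'"
    by (rule eventually_happens'[OF sequentially_bot])
  then obtain K where K: "\<And>w w' s. w \<in> W \<Longrightarrow> w' \<in> W \<Longrightarrow> w' \<noteq> w \<Longrightarrow> s \<in> S w \<Longrightarrow>
    dotp n (\<lambda>i. s i + far_shift n K w i) w + q K w < dotp n (\<lambda>i. s i + far_shift n K w i) w' + q K w'"
    by blast
  define S' where "S' w = (\<lambda>u i. u i + far_shift n K w i) ` S w" for w
  have fs: "far_shift n K w \<in> expo n" for w by (auto simp: far_shift_def expo_def)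
  have S': "indep n (init_ideal n w I) (S' w)" if "w \<in> W" for w
    unfolding S'_def using indep_translate[OF laurent_ideal_init[OF I] S[OF that] fs] .
  have lt: "dotp n u w + q K w < dotp n u w' + q K w'"
    if "w \<in> W" "w' \<in> W" "w' \<noteq> w" "u \<in> S' w" for w w' u
    using that K by (auto simp: S'_def)
  have disj: "S' w \<inter> S' w' = {}" if "w \<in> W" "w' \<in> W" "w \<noteq> w'" for w w'
  proof (rule ccontr)
    assume "S' w \<inter> S' w' \<noteq> {}"
    then obtain u where "u \<in> S' w" "u \<in> S' w'" by auto
    then show False using lt[of w w' u] lt[of w' w u] that by auto
  qed
  define T where "T = (\<Union>w\<in>W. S' w)"
  have fS': "finite (S' w)" if "w \<in> W" for w using fS[OF that] by (simp add: S'_def)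
  have "card T = (\<Sum>w\<in>W. card (S' w))"
    unfolding T_def using W fS' disj by (intro card_UN_disjoint) auto
  also have "\<dots> = (\<Sum>w\<in>W. card (S w))"
    by (simp add: S'_def card_translate)
  finally have cT: "card T = (\<Sum>w\<in>W. card (S w))" .
  have "indep n I T"
    unfolding indep_def
  proof (intro conjI ballI impI notI)
    show "finite T" using W fS' by (auto simp: T_def)
    show "T \<subseteq> expo n" using S' by (auto simp: T_def indep_def)
    fix f assume f: "f \<in> I" "f \<noteq> tzero" "supp f \<subseteq> T"
    define P where "P = {(w, u). w \<in> W \<and> u \<in> S' w \<and> u \<in> supp f}"
    define \<beta> where "\<beta> = (\<lambda>(w, u). (case f u of Fin c \<Rightarrow> c | TInf \<Rightarrow> 0) + dotp n u w + q K w)"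
    have "P \<subseteq> Sigma W S'" by (auto simp: P_def)
    then have finP: "finite P" using W fS' by (auto intro: finite_subset)
    have "supp f \<noteq> {}" using f by (simp add: supp_eq_empty_iff)
    then have "P \<noteq> {}" using f(3) by (fastforce simp: P_def T_def)
    then have "Min (\<beta> ` P) \<in> \<beta> ` P" using finP by (intro Min_in) auto
    then obtain w u where wu: "(w, u) \<in> P" "\<beta> (w, u) = Min (\<beta> ` P)" by force
    then have w: "w \<in> W" "u \<in> S' w" "u \<in> supp f" by (auto simp: P_def)
    have "\<not> argmin (twist (\<lambda>u. dotp n u w) f) \<subseteq> S' w"
      using S'[OF w(1)] f by (simp add: indep_init_iff[OF I])
    then obtain v where v: "v \<in> argmin (twist (\<lambda>u. dotp n u w) f)" "v \<notin> S' w" by auto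
    then have vs: "v \<in> supp f" by (auto simp: argmin_def)
    then obtain w' where w': "w' \<in> W" "v \<in> S' w'" using f(3) by (auto simp: T_def)
    have "(w', v) \<in> P" using vs w' by (simp add: P_def)
    then have le: "\<beta> (w, u) \<le> \<beta> (w', v)" using wu(2) finP by auto
    obtain a b where ab: "f u = Fin a" "f v = Fin b"
      using w(3) vs by (cases "f u"; cases "f v") (auto simp: supp_def)
    have "twist (\<lambda>u. dotp n u w) f v \<le> twist (\<lambda>u. dotp n u w) f u"
      using v by (simp add: argmin_def)
    then have "b + dotp n v w \<le> a + dotp n u w" using ab by (simp add: twist_def)
    moreover have "dotp n v w' + q K w' < dotp n v w + q K w"
      using lt[of w' w v] w' w v by auto
    ultimately show False using le ab by (simp add: \<beta>_def)
  qed
  with cT show ?thesis by blast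
qed

lemma has_rank_exists:
  assumes "\<And>S. indep n J S \<Longrightarrow> card S \<le> d"
  obtains r where "has_rank n J r" "r \<le> d"
proof -
  have "\<exists>S. indep n J S \<and> (\<forall>S'. indep n J S' \<longrightarrow> card S' \<le> card S)"
    using assms indep_empty[of n J]
    by (intro ex_has_greatest_nat[of "indep n J" "{}" card "Suc d"]) (auto simp: less_Suc_eq_le)
  then show thesis using that assms by (auto simp: has_rank_def)
qed

text \<open>Each point of the variety thus contributes at least 1 to the sum of ranks, which is what
  makes the variety finite.\<close>

lemma indep_init_singleton:
  assumes I: "laurent_ideal UNIV n I" and w: "w \<in> trop_variety n I"
  shows "indep n (init_ideal n w I) {\<lambda>i. 0}"
proof -
  have "\<not> argmin (twist (\<lambda>u. dotp n u w) f) \<subseteq> {\<lambda>i. 0}" if f: "f \<in> I" "f \<noteq> tzero" for f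
  proof
    assume "argmin (twist (\<lambda>u. dotp n u w) f) \<subseteq> {\<lambda>i. 0}"
    then have "card (argmin (twist (\<lambda>u. dotp n u w) f)) \<le> card {\<lambda>i::nat. 0::int}"
      by (intro card_mono) auto
    moreover have "2 \<le> card (argmin (twist (\<lambda>u. dotp n u w) f))"
      using w f min_terms_eq_argmin[OF laurent_ideal_finite[OF I f(1)] f(2), of n w]
      by (auto simp: trop_variety_def)
    ultimately show False by simp
  qed
  then show ?thesis by (auto simp: indep_init_iff[OF I] expo_def)
qed

lemma indep_init_empty:
  assumes I: "laurent_ideal UNIV n I" and w: "w \<in> rvec n" "w \<notin> trop_variety n I"
    and S: "indep n (init_ideal n w I) S"
  shows "S = {}"
proof (rule ccontr)
  assume "S \<noteq> {}"
  then obtain s where s: "s \<in> S" by auto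
  obtain f where f: "f \<in> I" "f \<noteq> tzero" "\<not> 2 \<le> card (min_terms n f w)"
    using w by (auto simp: trop_variety_def)
  let ?A = "argmin (twist (\<lambda>u. dotp n u w) f)"
  have fin: "finite (supp f)" using laurent_ideal_finite[OF I f(1)] .
  have "card ?A < 2" using f(3) min_terms_eq_argmin[OF fin f(2), of n w] by simp
  moreover have "finite ?A" using fin by (auto simp: argmin_def)
  moreover have "?A \<noteq> {}" using argmin_nonempty[of "twist (\<lambda>u. dotp n u w) f"] fin f by simp
  ultimately have "card ?A = 1" by (metis One_nat_def card_0_eq less_2_cases)
  then obtain u where u: "?A = {u}" by (auto simp: card_1_singleton_iff)
  then have "u \<in> supp f" by (auto simp: argmin_def)
  then have ue: "u \<in> expo n" using laurent_ideal_expo[OF I f(1)] by auto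
  have "S \<subseteq> expo n" using S by (simp add: indep_def)
  then have "(\<lambda>i. s i - u i) \<in> expo n" using s ue by (auto simp: expo_def)
  then have g: "mono_mult 0 (\<lambda>i. s i - u i) f \<in> I" using laurent_ideal_mult[OF I f(1)] by auto
  have "argmin (twist (\<lambda>u. dotp n u w) (mono_mult 0 (\<lambda>i. s i - u i) f)) \<subseteq> {s}"
    unfolding subset_iff argmin_twist_mult u by (auto simp: fun_eq_iff algebra_simps)
  then show False
    using S s g f(2) by (fastforce simp: indep_init_iff[OF I] mono_mult_eq_tzero_iff)
qed

section \<open>Relations with large gaps\<close>

definition l1 :: "nat \<Rightarrow> (nat \<Rightarrow> int) \<Rightarrow> int" where
  "l1 n u = (\<Sum>i<n. \<bar>u i\<bar>)"

lemma l1_nonneg: "0 \<le> l1 n u"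
  by (simp add: l1_def sum_nonneg)

lemma l1_add: "l1 n (\<lambda>i. u i + v i) \<le> l1 n u + l1 n v"
  unfolding l1_def sum.distrib[symmetric] by (intro sum_mono) simp

lemma l1_eq_0: "u \<in> expo n \<Longrightarrow> l1 n u = 0 \<Longrightarrow> u = (\<lambda>i. 0)"
proof
  fix i assume "u \<in> expo n" "l1 n u = 0"
  then show "u i = 0"
    by (cases "i < n") (auto simp: l1_def expo_def sum_nonneg_eq_0_iff)
qed

lemma finite_supp_gap:
  assumes "finite (supp f)" "\<And>v. v \<notin> T \<Longrightarrow> 0 < f v"
  obtains \<delta> where "0 < \<delta>" "\<And>v. v \<notin> T \<Longrightarrow> Fin \<delta> \<le> f v"
proof -
  \<comment> \<open>The element \<open>Fin 1\<close> keeps the set nonempty and its minimum finite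
    even if no term lies outside \<open>T\<close>.\<close>
  let ?M = "insert (Fin 1) (f ` (supp f - T))"
  have fin: "finite ?M" using assms(1) by simp
  have "0 < x" if "x \<in> ?M" for x
    using that assms(2) by auto
  then have pos: "0 < Min ?M"
    using Min_in[OF fin] by blast
  have "Min ?M \<le> Fin 1" using fin by (intro Min_le) auto
  then obtain \<delta> where \<delta>: "Min ?M = Fin \<delta>" by (cases "Min ?M") auto
  have "Fin \<delta> \<le> f v" if "v \<notin> T" for v
  proof (cases "v \<in> supp f")
    case True
    then have "f v \<in> ?M" using that by auto
    then show ?thesis unfolding \<delta>[symmetric] by (rule Min_le[OF fin])
  qed (auto simp: supp_def)
  then show thesis using that pos \<delta> by auto
qed

lemma l1_step:
  assumes u: "u \<in> expo n" "l1 n u = int (Suc k)"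
  obtains i s where "i < n" "s \<in> {1, -1}" "l1 n (\<lambda>j. u j - (if j = i then s else 0)) = int k"
proof -
  have "\<exists>i<n. u i \<noteq> 0"
  proof (rule ccontr)
    assume "\<not> (\<exists>i<n. u i \<noteq> 0)"
    then have "l1 n u = 0" by (simp add: l1_def)
    then show False using u by simp
  qed
  then obtain i where i: "i < n" "u i \<noteq> 0" by auto
  define s where "s = sgn (u i)"
  have s: "s \<in> {1, -1}" using i by (auto simp: s_def sgn_if)
  have "l1 n (\<lambda>j. u j - (if j = i then s else 0)) = (\<Sum>j<n. \<bar>u j\<bar> - (if j = i then 1 else 0))"
    unfolding l1_def using i by (intro sum.cong) (auto simp: s_def sgn_if)
  also have "\<dots> = l1 n u - 1" using i by (simp add: l1_def sum_subtractf)
  finally show thesis using that i s u by simp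
qed

text \<open>Abstracts the ideal twisted by a fixed point \<open>w\<close>, with \<open>T\<close> a
  largest independent set of the initial ideal. Scalars absorb the change of linear weight under a
  monomial shift, so \<open>shift\<close> is an exact translation. \<open>span\<close> is the
  maximality of \<open>T\<close>.\<close>

locale shift_space =
  fixes n :: nat and X :: "tvec set" and T :: "(nat \<Rightarrow> int) set"
  assumes X: "trop_linear_space X"
    and shift: "\<And>f v. f \<in> X \<Longrightarrow> v \<in> expo n \<Longrightarrow> (\<lambda>u. f (\<lambda>i. u i - v i)) \<in> X"
    and fin: "\<And>f. f \<in> X \<Longrightarrow> finite (supp f)"
    and sub: "\<And>f. f \<in> X \<Longrightarrow> supp f \<subseteq> expo n"
    and T: "finite T" "T \<subseteq> expo n"
    and span: "\<And>u. u \<in> expo n - T \<Longrightarrow>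
          \<exists>f\<in>X. f u = 0 \<and> (\<forall>v. 0 \<le> f v) \<and> (\<forall>v. v \<notin> insert u T \<longrightarrow> 0 < f v)"
begin

text \<open>\<open>\<delta>\<close> measures how well \<open>T\<close> spans \<open>u\<close>, and
  \<open>R\<close> how far from the origin the relation reaches. The lower bound needs the first to
  grow without the second growing too fast.\<close>

definition rel :: "(nat \<Rightarrow> int) \<Rightarrow> real \<Rightarrow> int \<Rightarrow> bool" where
  "rel u \<delta> R \<longleftrightarrow> (\<exists>f\<in>X. f u = 0 \<and> (\<forall>t\<in>T. 0 \<le> f t) \<and>
      (\<forall>v. v \<notin> insert u T \<longrightarrow> Fin \<delta> \<le> f v) \<and> supp f \<subseteq> {v. l1 n v \<le> R})"

lemma rel_mono: "rel u \<delta> R \<Longrightarrow> \<delta>' \<le> \<delta> \<Longrightarrow> R \<le> R' \<Longrightarrow> rel u \<delta>' R'"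
  unfolding rel_def by (elim bexE, rule bexI) (auto intro: order_trans[of "Fin \<delta>'" "Fin \<delta>"] order_trans[of _ R R'])

lemma rel_exists:
  assumes "u \<in> expo n - T"
  shows "\<exists>\<delta> R. 0 < \<delta> \<and> rel u \<delta> R"
proof -
  obtain f where f: "f \<in> X" "f u = 0" "\<forall>v. 0 \<le> f v" "\<forall>v. v \<notin> insert u T \<longrightarrow> 0 < f v"
    using span[OF assms] by blast
  obtain \<delta> where \<delta>: "0 < \<delta>" "\<And>v. v \<notin> insert u T \<Longrightarrow> Fin \<delta> \<le> f v"
    using finite_supp_gap[OF fin[OF f(1)], of "insert u T"] f(4) by blast
  have "supp f \<subseteq> {v. l1 n v \<le> Max (insert 0 (l1 n ` supp f))}"
    using fin[OF f(1)] by auto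
  then have "rel u \<delta> (Max (insert 0 (l1 n ` supp f)))"
    unfolding rel_def using f \<delta> by (intro bexI[of _ f]) auto
  with \<delta> show ?thesis by blast
qed

lemma rel_exists_finite:
  assumes "finite Y" "Y \<subseteq> expo n - T"
  shows "\<exists>\<delta> R. 0 < \<delta> \<and> 1 \<le> R \<and> (\<forall>y\<in>Y. rel y \<delta> R)"
  using assms
proof (induction Y rule: finite_induct)
  case empty
  show ?case by (intro exI[of _ 1]) auto
next
  case (insert y Y)
  then obtain \<delta> R where R: "0 < \<delta>" "1 \<le> R" "\<forall>y\<in>Y. rel y \<delta> R" by auto
  obtain \<delta>' R' where R': "0 < \<delta>'" "rel y \<delta>' R'" using rel_exists[of y] insert.prems by auto
  have "rel z (min \<delta> \<delta>') (max R R')" if "z \<in> insert y Y" for z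
    using that R(3) R'(2) by (auto intro: rel_mono)
  then show ?case using R R' by (intro exI[of _ "min \<delta> \<delta>'"] exI[of _ "max R R'"]) auto
qed

text \<open>Multiplying a relation by a variable only creates terms in a fixed finite set of
  neighbours of \<open>T\<close>, so one gap \<open>\<delta>\<close> serves all monomials.\<close>

lemma uniform_rel:
  obtains \<delta> R where "0 < \<delta>" "1 \<le> R" "\<And>u. u \<in> expo n - T \<Longrightarrow> rel u \<delta> (R + l1 n u)"
proof -
  define N where "N i s = (\<lambda>t j. t j + (if j = i then s else 0)) ` T" for i :: nat and s :: int
  \<comment> \<open>The origin starts the induction on the distance; the neighbours serve its step.
    Being finite, \<open>Y\<close> admits common constants.\<close>
  define Y where "Y = (insert (\<lambda>i. 0) (\<Union>i<n. \<Union>s\<in>{1,-1}. N i s)) - T"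
  have "finite Y" using T by (auto simp: Y_def N_def)
  moreover have Ye: "Y \<subseteq> expo n - T" using T by (auto simp: Y_def N_def expo_def)
  ultimately obtain \<delta> R where R: "0 < \<delta>" "1 \<le> R" "\<forall>y\<in>Y. rel y \<delta> R"
    using rel_exists_finite by blast
  have "rel u \<delta> (R + l1 n u)" if "u \<in> expo n - T" "l1 n u = int k" for u k
    using that
  proof (induction k arbitrary: u)
    case 0
    then have "u = (\<lambda>i. 0)" using l1_eq_0[of u n] by simp
    then have "u \<in> Y" using 0 by (auto simp: Y_def)
    then show ?case using R 0 by simp
  next
    case (Suc k)
    obtain i s where st: "i < n" "s \<in> {1, -1}" "l1 n (\<lambda>j. u j - (if j = i then s else 0)) = int k"
      using l1_step[of u n k] Suc.prems by auto
    define e where "e = (\<lambda>j. if j = i then s else 0)"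
    define u' where "u' = (\<lambda>j. u j - e j)"
    have "l1 n e = (\<Sum>j<n. if j = i then 1 else 0)"
      unfolding l1_def e_def using st by (intro sum.cong) auto
    then have e: "e \<in> expo n" "l1 n e = 1"
      using st by (auto simp: e_def expo_def)
    have u': "u' \<in> expo n" "l1 n u' = int k"
      using Suc.prems e st by (auto simp: u'_def expo_def e_def)
    have uu: "u = (\<lambda>j. u' j + e j)" by (auto simp: u'_def)
    show ?case
    proof (cases "u' \<in> T")
      case True
      then have "u \<in> N i s" unfolding N_def by (intro image_eqI[of _ _ u']) (simp_all add: uu e_def)
      then have "u \<in> Y" using Suc.prems st by (auto simp: Y_def)
      then show ?thesis using R l1_nonneg[of n u] by (auto intro: rel_mono)
    next
      case False
      then obtain f where f: "f \<in> X" "f u' = 0" "\<forall>t\<in>T. 0 \<le> f t"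
        "\<forall>v. v \<notin> insert u' T \<longrightarrow> Fin \<delta> \<le> f v" "supp f \<subseteq> {v. l1 n v \<le> R + int k}"
        using Suc.IH[of u'] u' unfolding rel_def by auto
      define f' where "f' = (\<lambda>v. f (\<lambda>j. v j - e j))"
      have f': "f' \<in> X" unfolding f'_def using shift[OF f(1) e(1)] .
      define Z where "Z = {v. l1 n v \<le> R + int (Suc k)}"
      have unshift: "v = w" if "(\<lambda>j. v j - e j) = (\<lambda>j. w j - e j)" for v w :: "nat \<Rightarrow> int"
        using that by (auto simp: fun_eq_iff)
      have Nin: "v \<in> N i s" if "(\<lambda>j. v j - e j) \<in> T" for v
        unfolding N_def using that by (intro image_eqI[of _ _ "\<lambda>j. v j - e j"]) (auto simp: e_def)
      have Nout: "(\<lambda>j. v j - e j) \<in> T" if v: "v \<in> N i s" for v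
      proof -
        obtain t where t: "t \<in> T" "v = (\<lambda>j. t j + (if j = i then s else 0))" using v by (auto simp: N_def)
        then have "(\<lambda>j. v j - e j) = t" by (auto simp: e_def fun_eq_iff)
        then show ?thesis using t by simp
      qed
      have \<delta>0: "0 \<le> Fin \<delta>" using R by simp
      \<comment> \<open>The relation of \<open>u'\<close> is moved by one unit. Terms from
        \<open>T\<close> that leave \<open>T\<close> are only known to be nonnegative, hence
        \<open>m = 0\<close>; reducing them by the relations of \<open>Y\<close> restores the gap.
        The move costs 1 in radius, which matches the growth of \<open>l1 n u\<close>.\<close>
      have "\<exists>h\<in>X. h u = 0 \<and> (\<forall>t\<in>T. 0 \<le> h t) \<and>
           (\<forall>v. v \<notin> insert u T \<longrightarrow> 0 + Fin \<delta> \<le> h v) \<and> supp h \<subseteq> Z"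
      proof (rule reduce_terms[OF X, of "N i s - T" u T "Fin \<delta>" 0 Z f'])
        show "finite (N i s - T)" using T by (simp add: N_def)
        show "u \<notin> N i s - T" using Nout[of u] False by (auto simp: u'_def)
        show "\<exists>g\<in>X. g y = 0 \<and> (\<forall>t\<in>T. 0 \<le> g t) \<and> (\<forall>v. v \<notin> insert y T \<longrightarrow> Fin \<delta> \<le> g v) \<and> supp g \<subseteq> Z"
          if "y \<in> N i s - T" for y
        proof -
          have "y \<in> Y" using that st by (auto simp: Y_def)
          then have "rel y \<delta> (R + int (Suc k))" using R by (auto intro: rel_mono)
          then show ?thesis by (simp add: rel_def Z_def)
        qed
        show "f' u = 0" using f(2) by (simp add: f'_def u'_def)
        show "0 \<le> f' t" if "t \<in> T" for t
        proof (cases "(\<lambda>j. t j - e j) \<in> insert u' T")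
          case True
          moreover have "t \<noteq> u" using that Suc.prems by auto
          ultimately show ?thesis using f(3) unshift[of t u] by (auto simp: f'_def u'_def)
        next
          case False
          then show ?thesis using f(4) order_trans[OF \<delta>0] by (simp add: f'_def)
        qed
        show "0 \<le> f' y" if "y \<in> N i s - T" for y
          using Nout[of y] that f(3) by (simp add: f'_def)
        show "0 + Fin \<delta> \<le> f' v" if "v \<notin> T" "v \<noteq> u" "v \<notin> N i s - T" for v
        proof -
          have "(\<lambda>j. v j - e j) \<notin> insert u' T"
            using that Nin[of v] unshift[of v u] by (auto simp: u'_def)
          then show ?thesis using f(4) by (simp add: f'_def)
        qed
        show "supp f' \<subseteq> Z"
        proof
          fix v assume "v \<in> supp f'"
          then have "(\<lambda>j. v j - e j) \<in> supp f" by (simp add: supp_def f'_def)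
          then have "l1 n (\<lambda>j. v j - e j) \<le> R + int k" using f(5) by auto
          then show "v \<in> Z" using l1_add[of n "\<lambda>j. v j - e j" e] e(2) by (simp add: Z_def)
        qed
      qed (use Suc.prems R f' in auto)
      then show ?thesis using Suc.prems by (simp add: rel_def Z_def)
    qed
  qed
  then have "rel u \<delta> (R + l1 n u)" if "u \<in> expo n - T" for u
    using that l1_nonneg[of n u] by (metis nonneg_int_cases)
  with R that show thesis by blast
qed

text \<open>Each round replaces all terms outside \<open>insert u T\<close> by their own relations.
  A term at distance \<open>l\<close> has one of radius \<open>R + l\<close>, so a round gains
  \<open>\<delta>\<close> in gap and costs only \<open>R\<close> in radius.\<close>

lemma deep_rel:
  assumes \<delta>: "0 < \<delta>" and R: "\<And>u. u \<in> expo n - T \<Longrightarrow> rel u \<delta> (R + l1 n u)"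
    and u: "u \<in> expo n - T"
  shows "rel u (real (Suc k) * \<delta>) (int (Suc k) * R + l1 n u)"
proof (induction k)
  case 0
  then show ?case using R[OF u] by simp
next
  case (Suc k)
  define Z where "Z = {v. l1 n v \<le> int (Suc (Suc k)) * R + l1 n u}"
  obtain f where f: "f \<in> X" "f u = 0" "\<forall>t\<in>T. 0 \<le> f t"
     "\<forall>v. v \<notin> insert u T \<longrightarrow> Fin (real (Suc k) * \<delta>) \<le> f v" "supp f \<subseteq> {v. l1 n v \<le> int (Suc k) * R + l1 n u}"
    using Suc.IH unfolding rel_def by blast
  obtain g where g: "supp g \<subseteq> {v. l1 n v \<le> R + l1 n u}" "g u = 0"
    using R[OF u] unfolding rel_def by blast
  then have "u \<in> supp g" by (simp add: supp_def)
  then have R0: "0 \<le> R" using g by auto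
  have "\<exists>h\<in>X. h u = 0 \<and> (\<forall>t\<in>T. 0 \<le> h t) \<and>
      (\<forall>v. v \<notin> insert u T \<longrightarrow> Fin (real (Suc k) * \<delta>) + Fin \<delta> \<le> h v) \<and> supp h \<subseteq> Z"
  proof (rule reduce_terms[OF X, of "supp f - insert u T" u T "Fin \<delta>" _ Z f])
    show "finite (supp f - insert u T)" using fin[OF f(1)] by simp
    show "\<exists>g\<in>X. g y = 0 \<and> (\<forall>t\<in>T. 0 \<le> g t) \<and> (\<forall>v. v \<notin> insert y T \<longrightarrow> Fin \<delta> \<le> g v) \<and> supp g \<subseteq> Z"
      if y: "y \<in> supp f - insert u T" for y
    proof -
      have "y \<in> expo n - T" using y sub[OF f(1)] by auto
      moreover have "l1 n y \<le> int (Suc k) * R + l1 n u" using y f(5) by auto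
      ultimately have "rel y \<delta> (int (Suc (Suc k)) * R + l1 n u)"
        using rel_mono[OF R[of y] order_refl] by (simp add: algebra_simps)
      then show ?thesis unfolding rel_def Z_def .
    qed
    show "Fin (real (Suc k) * \<delta>) + Fin \<delta> \<le> f v" if "v \<notin> T" "v \<noteq> u" "v \<notin> supp f - insert u T" for v
      using that by (auto simp: supp_def)
    show "supp f \<subseteq> Z" using f(5) R0 by (auto simp: Z_def algebra_simps)
  qed (use u \<delta> f in auto)
  then show ?case unfolding rel_def Z_def by (simp add: algebra_simps)
qed

end

section \<open>The paraboloid weight\<close>

definition sqn :: "nat \<Rightarrow> (nat \<Rightarrow> int) \<Rightarrow> real" where
  "sqn n u = (\<Sum>i<n. (of_int (u i))\<^sup>2)"

definition par :: "nat \<Rightarrow> nat \<Rightarrow> (nat \<Rightarrow> int) \<Rightarrow> real" where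
  "par n K u = - sqn n u / (2 * real K)"

lemma sum_squares_le_square_sum:
  fixes x :: "nat \<Rightarrow> real"
  shows "(\<Sum>i<n. (x i)\<^sup>2) \<le> (\<Sum>i<n. \<bar>x i\<bar>)\<^sup>2"
proof (induction n)
  case (Suc n)
  have "0 \<le> 2 * (\<Sum>i<n. \<bar>x i\<bar>) * \<bar>x n\<bar>"
    by (intro mult_nonneg_nonneg sum_nonneg) auto
  then have "(\<Sum>i<n. (x i)\<^sup>2) \<le> (\<Sum>i<n. \<bar>x i\<bar>)\<^sup>2 + 2 * (\<Sum>i<n. \<bar>x i\<bar>) * \<bar>x n\<bar>"
    using Suc.IH by linarith
  then show ?case by (simp add: power2_sum)
qed simp

lemma dotp_par:
  assumes "0 < K"
  shows "dotp n u w - par n K u =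
     (\<Sum>i<n. (of_int (u i) + real K * w i)\<^sup>2) / (2 * real K) - real K / 2 * (\<Sum>i<n. (w i)\<^sup>2)"
proof -
  have "of_int (u i) * w i + (of_int (u i))\<^sup>2 / (2 * real K) =
     (of_int (u i) + real K * w i)\<^sup>2 / (2 * real K) - real K / 2 * (w i)\<^sup>2" for i
    using assms by (simp add: power2_eq_square field_simps)
  then have "(\<Sum>i<n. of_int (u i) * w i + (of_int (u i))\<^sup>2 / (2 * real K)) =
     (\<Sum>i<n. (of_int (u i) + real K * w i)\<^sup>2 / (2 * real K) - real K / 2 * (w i)\<^sup>2)" by simp
  then show ?thesis
    by (simp add: dotp_def par_def sqn_def sum.distrib sum_subtractf sum_divide_distrib sum_distrib_left)
qed

section \<open>The lower bound\<close>

lemma shift_space_twist: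
  assumes I: "laurent_ideal UNIV n I" and lin: "trop_linear_space I"
    and r: "has_rank n (init_ideal n w I) r" and T: "indep n (init_ideal n w I) T" "card T = r"
  shows "shift_space n (twist (\<lambda>u. dotp n u w) ` I) T"
proof
  let ?h = "\<lambda>u. dotp n u w"
  show "trop_linear_space (twist ?h ` I)" by (rule trop_linear_space_twist[OF lin])
  show "finite T" "T \<subseteq> expo n" using T by (auto simp: indep_def)
  show "finite (supp F)" if "F \<in> twist ?h ` I" for F
    using that laurent_ideal_finite[OF I] by auto
  show "supp F \<subseteq> expo n" if "F \<in> twist ?h ` I" for F
    using that laurent_ideal_expo[OF I] by fastforce
  show "(\<lambda>u. F (\<lambda>i. u i - v i)) \<in> twist ?h ` I" if "F \<in> twist ?h ` I" "v \<in> expo n" for F v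
  proof -
    obtain f where f: "f \<in> I" "F = twist ?h f" using \<open>F \<in> twist ?h ` I\<close> by auto
    have "(\<lambda>u. F (\<lambda>i. u i - v i)) = twist ?h (mono_mult (- dotp n v w) v f)"
    proof
      fix u
      show "F (\<lambda>i. u i - v i) = twist ?h (mono_mult (- dotp n v w) v f) u"
        by (cases "f (\<lambda>i. u i - v i)") (simp_all add: f twist_def mono_mult_eq dotp_diff)
    qed
    then show ?thesis using laurent_ideal_mult[OF I f(1) _ that(2)] by auto
  qed
  fix u assume u: "u \<in> expo n - T"
  \<comment> \<open>\<open>T\<close> has the largest cardinality, so adding \<open>u\<close> creates
    a dependence; \<open>u\<close> is among its minimal terms because \<open>T\<close> alone is
    independent.\<close>
  have "\<not> indep n (init_ideal n w I) (insert u T)"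
    using r T u \<open>finite T\<close> unfolding has_rank_def by (metis DiffD2 card_insert_disjoint not_less_eq_eq order_refl)
  then obtain f where f: "f \<in> I" "f \<noteq> tzero" "argmin (twist ?h f) \<subseteq> insert u T"
    using \<open>finite T\<close> \<open>T \<subseteq> expo n\<close> u by (auto simp: indep_init_iff[OF I])
  have "u \<in> argmin (twist ?h f)"
    using T(1) f by (auto simp: indep_init_iff[OF I])
  then obtain a where a: "twist ?h f u = Fin a" and le: "\<And>v. twist ?h f u \<le> twist ?h f v"
    by (cases "twist ?h f u") (auto simp: argmin_def supp_def twist_def)
  define g where "g = mono_mult (-a) (\<lambda>i. 0) f"
  have "g \<in> I" unfolding g_def using laurent_ideal_mult[OF I f(1)] by (auto simp: expo_def)
  have gv: "twist ?h g v = Fin (-a) + twist ?h f v" for v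
    by (simp add: g_def twist_def mono_mult_eq add.assoc)
  have lt: "Fin a < twist ?h f v" if "v \<notin> insert u T" for v
  proof (rule ccontr)
    assume "\<not> Fin a < twist ?h f v"
    then have "twist ?h f v = Fin a" using le[of v] a by auto
    then have "v \<in> argmin (twist ?h f)" using a le unfolding argmin_def supp_def by auto
    then show False using f(3) that by auto
  qed
  have "twist ?h g u = 0" using gv[of u] a by (simp add: zero_trop_def)
  moreover have "0 \<le> twist ?h g v" for v
    using le[of v] a gv[of v] by (cases "twist ?h f v") auto
  moreover have "0 < twist ?h g v" if "v \<notin> insert u T" for v
    using lt[OF that] gv[of v] by (cases "twist ?h f v") auto
  ultimately show "\<exists>F\<in>twist ?h ` I. F u = 0 \<and> (\<forall>v. 0 \<le> F v) \<and> (\<forall>v. v \<notin> insert u T \<longrightarrow> 0 < F v)"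
    using \<open>g \<in> I\<close> by blast
qed

text \<open>By completing the square, the concave weight \<open>par\<close> differs from the linear weight \<open>w\<close> by
  \<open>|u + K w|\<^sup>2 / 2K\<close> and a constant. Within distance \<open>O(\<kappa> K)\<close> of \<open>- K w\<close> this is \<open>O(\<kappa>\<^sup>2 K)\<close>, less
  than the gap of order \<open>\<kappa> K\<close> that relations of radius \<open>O(\<kappa> K)\<close> can achieve.\<close>

lemma cluster_bound:
  assumes I: "laurent_ideal UNIV n I" and lin: "trop_linear_space I"
    and r: "has_rank n (init_ideal n w I) r"
  obtains \<eta> where "0 < \<eta>"
    "\<forall>\<^sub>F K in sequentially. \<forall>A B. finite B \<longrightarrow>
       (\<forall>u\<in>expo n. (\<forall>i<n. \<bar>of_int (u i)\<bar> \<le> real K * (\<bar>w i\<bar> + 1)) \<longrightarrow> u \<in> A) \<longrightarrow> B \<subseteq> expo n \<longrightarrow>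
       (\<forall>f\<in>I. f \<noteq> tzero \<longrightarrow> supp f \<subseteq> A \<longrightarrow> \<not> argmin (twist (par n K) f) \<subseteq> B) \<longrightarrow>
       card {b \<in> B. (\<Sum>i<n. \<bar>of_int (b i) + real K * w i\<bar>) < \<eta> * real K} \<le> r"
proof -
  let ?h = "\<lambda>u. dotp n u w"
  obtain T where T0: "indep n (init_ideal n w I) T" "card T = r" using r by (auto simp: has_rank_def)
  interpret shift_space n "twist ?h ` I" T using shift_space_twist[OF I lin r T0] .
  obtain \<delta> R where \<delta>: "0 < \<delta>" and R: "1 \<le> R"
    and relR: "\<And>u. u \<in> expo n - T \<Longrightarrow> rel u \<delta> (R + l1 n u)"
    using uniform_rel by blast
  define \<rho> where "\<rho> = real_of_int R"
  have \<rho>: "1 \<le> \<rho>" using R by (simp add: \<rho>_def)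
  \<comment> \<open>The first bound makes the quadratic error
    \<open>(3 * \<kappa> * \<rho> * K)\<^sup>2 / (2 * K)\<close> at most 9/10 of
    \<open>\<delta> * \<kappa> * K\<close>. The second keeps supports within \<open>K\<close> of
    \<open>- K w\<close>, hence inside \<open>A\<close>.\<close>
  define \<kappa> where "\<kappa> = min (\<delta> / (5 * \<rho>\<^sup>2)) (1 / (3 * \<rho>))"
  have \<kappa>: "0 < \<kappa>" using \<delta> \<rho> by (simp add: \<kappa>_def)
  have k1: "5 * \<kappa> * \<rho>\<^sup>2 \<le> \<delta>"
  proof -
    have "\<kappa> \<le> \<delta> / (5 * \<rho>\<^sup>2)" by (simp add: \<kappa>_def)
    then show ?thesis using \<rho> by (simp add: field_simps)
  qed
  have k2: "3 * \<kappa> * \<rho> \<le> 1"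
  proof -
    have "\<kappa> \<le> 1 / (3 * \<rho>)" by (simp add: \<kappa>_def)
    then show ?thesis using \<rho> by (simp add: field_simps)
  qed
  have "\<forall>\<^sub>F K in sequentially. (\<rho> + 2 * real n) / (\<kappa> * \<rho>) < real K"
    using filterlim_real_sequentially by (rule filterlim_at_top_dense[THEN iffD1, rule_format])
  then have "\<forall>\<^sub>F K in sequentially. \<forall>A B. finite B \<longrightarrow>
       (\<forall>u\<in>expo n. (\<forall>i<n. \<bar>of_int (u i)\<bar> \<le> real K * (\<bar>w i\<bar> + 1)) \<longrightarrow> u \<in> A) \<longrightarrow> B \<subseteq> expo n \<longrightarrow>
       (\<forall>f\<in>I. f \<noteq> tzero \<longrightarrow> supp f \<subseteq> A \<longrightarrow> \<not> argmin (twist (par n K) f) \<subseteq> B) \<longrightarrow>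
       card {b \<in> B. (\<Sum>i<n. \<bar>of_int (b i) + real K * w i\<bar>) < (\<kappa> * \<rho>) * real K} \<le> r"
  proof (eventually_elim, intro allI impI)
    fix K A B
    assume K: "(\<rho> + 2 * real n) / (\<kappa> * \<rho>) < real K" and B: "finite B" "B \<subseteq> expo n"
      and A: "\<forall>u\<in>expo n. (\<forall>i<n. \<bar>of_int (u i)\<bar> \<le> real K * (\<bar>w i\<bar> + 1)) \<longrightarrow> u \<in> A"
      and ind: "\<forall>f\<in>I. f \<noteq> tzero \<longrightarrow> supp f \<subseteq> A \<longrightarrow> \<not> argmin (twist (par n K) f) \<subseteq> B"
    define S where "S = {b \<in> B. (\<Sum>i<n. \<bar>of_int (b i) + real K * w i\<bar>) < (\<kappa> * \<rho>) * real K}"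
    have K': "\<rho> + 2 * real n < \<kappa> * \<rho> * real K"
      using K \<kappa> \<rho> by (simp add: field_simps)
    have K0: "0 < K"
    proof (rule ccontr)
      assume "\<not> 0 < K"
      then show False using K' \<rho> by simp
    qed
    define v where "v = far_shift n K w"
    have ve: "v \<in> expo n" by (auto simp: v_def far_shift_def expo_def)
    have vi: "\<bar>of_int (v i) + real K * w i\<bar> \<le> 1" if "i < n" for i
      using that by (simp add: v_def far_shift_def) linarith
    \<comment> \<open>The cluster is recentred at the origin, where \<open>T\<close> lives and where
      radii are measured.\<close>
    define S' where "S' = (\<lambda>u i. u i + - v i) ` S"
    have cS': "card S' = card S" unfolding S'_def by (rule card_translate)
    show "card S \<le> r"
    proof (rule ccontr)
      assume "\<not> card S \<le> r"
      then have cS: "card T < card S'" using T0 cS' by simp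
      have finS': "finite S'" using B by (simp add: S'_def S_def)
      \<comment> \<open>Chosen so that \<open>Suc k\<close> is the ceiling of
        \<open>\<kappa> * K\<close>, the number of reduction rounds.\<close>
      define k where "k = nat \<lceil>\<kappa> * real K\<rceil> - 1"
      have "0 < \<kappa> * real K" using \<kappa> K0 by simp
      then have "1 \<le> \<lceil>\<kappa> * real K\<rceil>" by linarith
      then have Sk: "real (Suc k) = of_int \<lceil>\<kappa> * real K\<rceil>" by (simp add: k_def of_nat_diff)
      then have k: "\<kappa> * real K \<le> real (Suc k)" "real (Suc k) \<le> \<kappa> * real K + 1" by linarith+
      \<comment> \<open>Of the radius \<open>3 * \<kappa> * \<rho> * K\<close>, one third is spent
        on the rounds, one third on the distance of \<open>b\<close>, and the last absorbs
        \<open>\<rho> + 2 * n\<close> from the ceiling and the two roundings. The subtracted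
        \<open>n\<close> is for undoing the shift by \<open>v\<close>.\<close>
      define Z where "Z = {u. real_of_int (l1 n u) \<le> 3 * \<kappa> * \<rho> * real K - real n}"
      have "\<exists>F\<in>twist ?h ` I. (\<forall>u\<in>S'. 0 \<le> F u) \<and> (\<exists>u\<in>S'. F u = 0) \<and>
              (\<forall>u. u \<notin> S' \<longrightarrow> Fin (real (Suc k) * \<delta>) \<le> F u) \<and> supp F \<subseteq> Z"
      proof (rule exchange[OF X _ finS' T(1) cS])
        show "0 < Fin (real (Suc k) * \<delta>)" using \<delta> by simp
        fix b assume b: "b \<in> S' - T"
        then obtain c where c: "c \<in> S" "b = (\<lambda>i. c i + - v i)" by (auto simp: S'_def)
        then have "b \<in> expo n - T" using b B ve by (auto simp: S_def expo_def)
        then have "rel b (real (Suc k) * \<delta>) (int (Suc k) * R + l1 n b)"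
          using deep_rel[OF \<delta>, of R b k] relR by blast
        then obtain f where f: "f\<in>twist ?h ` I" "f b = 0" "\<forall>t\<in>T. 0 \<le> f t"
          "\<forall>v. v \<notin> insert b T \<longrightarrow> Fin (real (Suc k) * \<delta>) \<le> f v" "supp f \<subseteq> {v. l1 n v \<le> int (Suc k) * R + l1 n b}"
          unfolding rel_def by blast
        have "real_of_int (l1 n b) \<le> (\<Sum>i<n. \<bar>of_int (c i) + real K * w i\<bar> + 1)"
          unfolding l1_def of_int_sum
        proof (rule sum_mono)
          fix i assume "i \<in> {..<n}"
          then show "of_int \<bar>b i\<bar> \<le> \<bar>of_int (c i) + real K * w i\<bar> + 1"
            using vi[of i] by (simp add: c(2))
        qed
        also have "\<dots> \<le> \<kappa> * \<rho> * real K + real n"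
          using c(1) by (simp add: S_def sum.distrib)
        finally have lb: "real_of_int (l1 n b) \<le> \<kappa> * \<rho> * real K + real n" .
        have "real (Suc k) * \<rho> \<le> (\<kappa> * real K + 1) * \<rho>" using k \<rho> by (intro mult_right_mono) auto
        then have "real (Suc k) * \<rho> + real_of_int (l1 n b) \<le> 3 * \<kappa> * \<rho> * real K - real n"
          using lb K' by (simp add: algebra_simps)
        moreover have "real_of_int (int (Suc k) * R + l1 n b) = real (Suc k) * \<rho> + real_of_int (l1 n b)"
          by (simp add: \<rho>_def)
        ultimately have bd: "real_of_int (int (Suc k) * R + l1 n b) \<le> 3 * \<kappa> * \<rho> * real K - real n" by linarith
        have "supp f \<subseteq> Z"
        proof
          fix x assume "x \<in> supp f"
          then have "l1 n x \<le> int (Suc k) * R + l1 n b" using f(5) by auto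
          then have "real_of_int (l1 n x) \<le> real_of_int (int (Suc k) * R + l1 n b)" by (rule of_int_le_iff[THEN iffD2])
          then show "x \<in> Z" using bd unfolding Z_def by simp
        qed
        then show "\<exists>f\<in>twist ?h ` I. f b = 0 \<and> (\<forall>t\<in>T. 0 \<le> f t) \<and>
              (\<forall>v. v \<notin> insert b T \<longrightarrow> Fin (real (Suc k) * \<delta>) \<le> f v) \<and> supp f \<subseteq> Z"
          using f by blast
      qed
      then obtain f b' where f: "f \<in> I" and b': "b' \<in> S'" "twist ?h f b' = 0"
        and off: "\<And>u. u \<notin> S' \<Longrightarrow> Fin (real (Suc k) * \<delta>) \<le> twist ?h f u" and fZ: "supp f \<subseteq> Z"
        by auto
      define g where "g = mono_mult 0 v f"
      have gI: "g \<in> I" unfolding g_def using laurent_ideal_mult[OF I f _ ve] by auto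
      have "f b' \<noteq> TInf" using b'(2) by (auto simp: twist_def)
      then have "f \<noteq> tzero" by (auto simp: tzero_def)
      then have g0: "g \<noteq> tzero" by (simp add: g_def mono_mult_eq_tzero_iff)
      have near: "(\<Sum>i<n. \<bar>of_int (u i) + real K * w i\<bar>) \<le> 3 * \<kappa> * \<rho> * real K" if "u \<in> supp g" for u
      proof -
        have "(\<lambda>i. u i - v i) \<in> Z" using that fZ by (auto simp: g_def supp_mono_mult)
        then have "(\<Sum>i<n. \<bar>of_int (u i - v i)\<bar>) \<le> 3 * \<kappa> * \<rho> * real K - real n"
          by (simp add: Z_def l1_def)
        moreover have "(\<Sum>i<n. \<bar>of_int (u i) + real K * w i\<bar>) \<le> (\<Sum>i<n. \<bar>of_int (u i - v i)\<bar> + 1)"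
        proof (rule sum_mono)
          fix i assume "i \<in> {..<n}"
          then show "\<bar>of_int (u i) + real K * w i\<bar> \<le> \<bar>of_int (u i - v i)\<bar> + 1"
            using vi[of i] by simp
        qed
        ultimately show ?thesis by (simp add: sum.distrib)
      qed
      have "supp g \<subseteq> A"
      proof
        fix u assume u: "u \<in> supp g"
        have "\<bar>of_int (u i)\<bar> \<le> real K * (\<bar>w i\<bar> + 1)" if "i < n" for i
        proof -
          have "\<bar>of_int (u i) + real K * w i\<bar> \<le> (\<Sum>i<n. \<bar>of_int (u i) + real K * w i\<bar>)"
            using that by (intro member_le_sum) auto
          also have "\<dots> \<le> 3 * \<kappa> * \<rho> * real K" by (rule near[OF u])
          also have "\<dots> \<le> 1 * real K" using k2 by (intro mult_right_mono) auto
          finally have "\<bar>of_int (u i) + real K * w i\<bar> \<le> real K" by simp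
          moreover have "\<bar>real K * w i\<bar> = real K * \<bar>w i\<bar>" by (simp add: abs_mult)
          ultimately show ?thesis by (simp add: algebra_simps)
        qed
        then show "u \<in> A" using A u laurent_ideal_expo[OF I gI] by blast
      qed
      then obtain u where u: "u \<in> argmin (twist (par n K) g)" "u \<notin> B" using ind gI g0 by blast
      have us: "u \<in> supp g" using u by (auto simp: argmin_def)
      obtain b where b: "b \<in> S" "b' = (\<lambda>i. b i - v i)" using b' by (auto simp: S'_def)
      have "(\<lambda>i. u i - v i) \<notin> S'"
      proof
        assume "(\<lambda>i. u i - v i) \<in> S'"
        then obtain c where "c \<in> S" "(\<lambda>i. u i - v i) = (\<lambda>i. c i + - v i)" by (auto simp: S'_def)
        moreover from this(2) have "u = c" by (auto simp: fun_eq_iff)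
        ultimately show False using u by (simp add: S_def)
      qed
      from off[OF this] have o: "Fin (real (Suc k) * \<delta>) \<le> twist ?h f (\<lambda>i. u i - v i)" .
      obtain x where x: "f (\<lambda>i. u i - v i) = Fin x"
        using us by (cases "f (\<lambda>i. u i - v i)") (auto simp: g_def supp_def mono_mult_eq)
      obtain y where y: "f b' = Fin y" using \<open>f b' \<noteq> TInf\<close> by (cases "f b'") auto
      have gu: "g u = Fin x" using x by (simp add: g_def mono_mult_eq)
      have gb: "g b = Fin y" using y b by (simp add: g_def mono_mult_eq)
      have "twist (par n K) g u \<le> twist (par n K) g b" using u by (simp add: argmin_def)
      then have e1: "x + par n K u \<le> y + par n K b" by (simp add: twist_def gu gb)
      have e2: "y + (dotp n b w - dotp n v w) = 0"
        using b'(2) y b by (simp add: twist_def dotp_diff zero_trop_def)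
      have e3: "real (Suc k) * \<delta> \<le> x + (dotp n u w - dotp n v w)"
        using o x by (simp add: twist_def dotp_diff)
      \<comment> \<open>The term \<open>u\<close> lies outside the cluster, so its linear weight
        exceeds that of \<open>b\<close> by the gap, yet its quadratic weight is no larger. The
        difference of the two weights must account for the whole gap.\<close>
      have "real (Suc k) * \<delta> \<le> (dotp n u w - par n K u) - (dotp n b w - par n K b)"
        using e1 e2 e3 by linarith
      also have "\<dots> = (\<Sum>i<n. (of_int (u i) + real K * w i)\<^sup>2) / (2 * real K) -
          (\<Sum>i<n. (of_int (b i) + real K * w i)\<^sup>2) / (2 * real K)"
        unfolding dotp_par[OF K0] by simp
      also have "\<dots> \<le> (\<Sum>i<n. (of_int (u i) + real K * w i)\<^sup>2) / (2 * real K)"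
        by (simp add: sum_nonneg)
      also have "\<dots> \<le> (3 * \<kappa> * \<rho> * real K)\<^sup>2 / (2 * real K)"
      proof (rule divide_right_mono)
        have "(\<Sum>i<n. (of_int (u i) + real K * w i)\<^sup>2) \<le> (\<Sum>i<n. \<bar>of_int (u i) + real K * w i\<bar>)\<^sup>2"
          by (rule sum_squares_le_square_sum)
        also have "\<dots> \<le> (3 * \<kappa> * \<rho> * real K)\<^sup>2"
          using near[OF us] by (intro power_mono) (auto intro: sum_nonneg)
        finally show "(\<Sum>i<n. (of_int (u i) + real K * w i)\<^sup>2) \<le> (3 * \<kappa> * \<rho> * real K)\<^sup>2" .
      qed simp
      also have "\<dots> = (9/10) * (5 * \<kappa> * \<rho>\<^sup>2) * (\<kappa> * real K)"
        using K0 by (simp add: power2_eq_square)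
      also have "\<dots> \<le> (9/10) * \<delta> * (\<kappa> * real K)"
        using k1 \<kappa> by (intro mult_right_mono mult_left_mono) auto
      also have "\<dots> < \<delta> * (\<kappa> * real K)"
        using \<delta> \<open>0 < \<kappa> * real K\<close> by simp
      also have "\<dots> \<le> real (Suc k) * \<delta>"
        using k(1) \<delta> by (simp add: mult.commute)
      finally show False by simp
    qed
  qed
  moreover have "0 < \<kappa> * \<rho>" using \<kappa> \<rho> by simp
  ultimately show thesis using that by blast
qed

section \<open>Coordinate bounds uniform in the scale\<close>

lemma finite_supp_lower_bound:
  assumes "finite (supp f)"
  obtains C where "0 \<le> C" "\<And>v. Fin (- C) \<le> f v"
proof -
  define c where "c v = (case f v of Fin c \<Rightarrow> c | TInf \<Rightarrow> 0)" for v
  define C where "C = (\<Sum>v\<in>supp f. \<bar>c v\<bar>)"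
  have "Fin (- C) \<le> f v" for v
  proof (cases "f v")
    case (Fin a)
    then have "\<bar>c v\<bar> \<le> C"
      unfolding C_def using assms by (intro member_le_sum) (auto simp: supp_def)
    then show ?thesis using Fin by (simp add: c_def)
  qed simp
  moreover have "0 \<le> C" by (simp add: C_def sum_nonneg)
  ultimately show thesis using that by blast
qed

text \<open>Finite rank makes \<open>d + 1\<close> consecutive powers of one variable dependent.
  Shifting an extreme term to the origin leaves all other terms in the direction \<open>- s\<close>,
  which for a coordinate of sign \<open>s\<close> points towards zero.\<close>

lemma axis_relation:
  assumes I: "laurent_ideal UNIV n I" and d: "has_rank n I d" and i: "i < n" and s: "s \<in> {1, -1 :: int}"
  shows "\<exists>f\<in>I. f (\<lambda>l. 0) = 0 \<and> supp f \<subseteq> (\<lambda>j l. if l = i then - s * int j else 0) ` {..d}"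
proof -
  define m where "m j = (\<lambda>l. if l = i then - s * int j else 0)" for j
  have inj: "inj m"
  proof (rule injI)
    fix x y assume "m x = m y"
    then have "m x i = m y i" by simp
    then show "x = y" using s by (auto simp: m_def)
  qed
  have me: "m j \<in> expo n" for j using i by (auto simp: m_def expo_def)
  have "card (m ` {..d}) = Suc d" using inj by (simp add: card_image inj_on_subset)
  then have "\<not> indep n I (m ` {..d})" using d by (metis has_rank_def not_less_eq_eq order_refl)
  then obtain f where f: "f \<in> I" "f \<noteq> tzero" "supp f \<subseteq> m ` {..d}"
    using me by (auto simp: indep_def)
  then obtain j where "m j \<in> supp f" by (metis imageE subsetD all_not_in_conv supp_eq_empty_iff)
  define j0 where "j0 = (LEAST j. m j \<in> supp f)"
  have j0: "m j0 \<in> supp f" unfolding j0_def using \<open>m j \<in> supp f\<close> by (rule LeastI)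
  have least: "j0 \<le> j" if "m j \<in> supp f" for j unfolding j0_def using that by (rule Least_le)
  obtain a where a: "f (m j0) = Fin a" using j0 by (cases "f (m j0)") (auto simp: supp_def)
  define g where "g = mono_mult (-a) (\<lambda>l. - m j0 l) f"
  have "(\<lambda>l. - m j0 l) \<in> expo n" using me[of j0] by (auto simp: expo_def)
  then have "g \<in> I" unfolding g_def using laurent_ideal_mult[OF I f(1)] by auto
  moreover have "g (\<lambda>l. 0) = 0" using a by (simp add: g_def mono_mult_eq zero_trop_def)
  moreover have "supp g \<subseteq> m ` {..d}"
  proof
    fix u assume "u \<in> supp g"
    then have "(\<lambda>l. u l + m j0 l) \<in> supp f" by (simp add: g_def supp_mono_mult)
    then obtain j where j: "j \<le> d" "(\<lambda>l. u l + m j0 l) = m j" using f(3) by auto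
    have "j0 \<le> j" using least[of j] j(2) \<open>(\<lambda>l. u l + m j0 l) \<in> supp f\<close> by simp
    have "u l = m (j - j0) l" for l
      using fun_cong[OF j(2), of l] \<open>j0 \<le> j\<close> by (auto simp: m_def of_nat_diff algebra_simps split: if_splits)
    then have "u = m (j - j0)" by auto
    then show "u \<in> m ` {..d}" using j(1) by auto
  qed
  ultimately show ?thesis by (auto simp: m_def)
qed

text \<open>If \<open>b\<close> were too far out, multiplying the axis relation by the monomial
  \<open>b\<close> would give terms closer to zero in coordinate \<open>i\<close>, still inside the
  box. Their weight exceeds that of \<open>b\<close> by more than the coefficients can offset, so
  \<open>b\<close> would be the only minimal term, against the choice of \<open>B\<close>. The
  constant depends neither on \<open>K\<close> nor on the box.\<close>

lemma axis_bound:
  assumes I: "laurent_ideal UNIV n I" and d: "has_rank n I d" and i: "i < n" and s: "s \<in> {1, -1 :: int}"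
  shows "\<exists>C\<ge>0. \<forall>K r B b. 0 < K \<longrightarrow> B \<subseteq> box n r \<longrightarrow>
      (\<forall>f\<in>I. f \<noteq> tzero \<longrightarrow> supp f \<subseteq> box n r \<longrightarrow> \<not> argmin (twist (par n K) f) \<subseteq> B) \<longrightarrow>
      b \<in> B \<longrightarrow> \<bar>b i\<bar> = s * b i \<longrightarrow> \<bar>of_int (b i)\<bar> \<le> C * real K"
proof -
  define m where "m j = (\<lambda>l. if l = i then - s * int j else 0)" for j
  obtain f where f: "f \<in> I" "f (\<lambda>l. 0) = 0" "supp f \<subseteq> m ` {..d}"
    using axis_relation[OF I d i s] unfolding m_def by blast
  obtain C0 where C0: "0 \<le> C0" "\<And>v. Fin (- C0) \<le> f v"
    using finite_supp_lower_bound[OF laurent_ideal_finite[OF I f(1)]] by blast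
  \<comment> \<open>The summand \<open>d\<close> ensures that at most \<open>d\<close> steps do not
    pass zero and that \<open>2 * \<beta> - j \<ge> \<beta>\<close>; the summand
    \<open>2 * C0\<close> outweighs the most negative coefficient.\<close>
  have "\<bar>of_int (b i)\<bar> \<le> (real d + 2 * C0) * real K"
    if K: "0 < K" and B: "B \<subseteq> box n r"
      and ind: "\<forall>f\<in>I. f \<noteq> tzero \<longrightarrow> supp f \<subseteq> box n r \<longrightarrow> \<not> argmin (twist (par n K) f) \<subseteq> B"
      and b: "b \<in> B" and sb: "\<bar>b i\<bar> = s * b i" for K r B b
  proof (rule ccontr)
    assume "\<not> \<bar>of_int (b i)\<bar> \<le> (real d + 2 * C0) * real K"
    then have big: "(real d + 2 * C0) * real K < \<bar>of_int (b i)\<bar>" by simp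
    define \<beta> where "\<beta> = real_of_int \<bar>b i\<bar>"
    have "real d * 1 \<le> real d * real K" using K by (intro mult_left_mono) auto
    moreover have "0 \<le> 2 * C0 * real K" "0 \<le> real d * real K" using C0(1) by auto
    moreover have "real d * real K + 2 * C0 * real K < \<beta>" using big by (simp add: \<beta>_def distrib_right)
    ultimately have \<beta>: "real d < \<beta>" "2 * C0 * real K < \<beta>" by linarith+
    have bbox: "b \<in> box n r" using b B by auto
    then have be: "b \<in> expo n" by (simp add: box_def)
    define g where "g = mono_mult 0 b f"
    have gI: "g \<in> I" unfolding g_def using laurent_ideal_mult[OF I f(1) _ be] by auto
    have gb: "g b = 0" using f(2) by (simp add: g_def mono_mult_eq zero_trop_def[symmetric])
    then have g0: "g \<noteq> tzero" by (auto simp: tzero_def)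
    have form: "\<exists>j\<le>d. u = (\<lambda>l. b l + m j l)" if "u \<in> supp g" for u
    proof -
      have "(\<lambda>l. u l - b l) \<in> supp f" using that by (simp add: g_def supp_mono_mult)
      then obtain j where j: "j \<le> d" "(\<lambda>l. u l - b l) = m j" using f(3) by auto
      then have "u = (\<lambda>l. b l + m j l)" by (auto simp: fun_eq_iff algebra_simps)
      then show ?thesis using j(1) by auto
    qed
    have "supp g \<subseteq> box n r"
    proof
      fix u assume u: "u \<in> supp g"
      then obtain j where j: "j \<le> d" "u = (\<lambda>l. b l + m j l)" using form by auto
      have jb: "int j \<le> \<bar>b i\<bar>" using j(1) \<beta>(1) by (simp add: \<beta>_def)
      have "\<bar>u l\<bar> \<le> r" if "l < n" for l
      proof (cases "l = i")
        case True
        have "\<bar>u i\<bar> \<le> \<bar>b i\<bar>" using s sb jb by (auto simp: j(2) m_def)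
        also have "\<dots> \<le> r" using bbox i by (auto simp: box_def)
        finally show ?thesis using True by simp
      next
        case False
        then show ?thesis using bbox that by (auto simp: box_def j(2) m_def)
      qed
      then show "u \<in> box n r" using u laurent_ideal_expo[OF I gI] by (auto simp: box_def)
    qed
    then obtain u where u: "u \<in> argmin (twist (par n K) g)" "u \<notin> B" using ind gI g0 by blast
    then have us: "u \<in> supp g" by (auto simp: argmin_def)
    obtain j where j: "j \<le> d" "u = (\<lambda>l. b l + m j l)" using form[OF us] by auto
    have "j \<noteq> 0"
    proof
      assume "j = 0"
      then have "u = b" by (auto simp: j(2) m_def)
      then show False using u b by simp
    qed
    then have j1: "1 \<le> real j" by simp
    have "(of_int (u l))\<^sup>2 = (of_int (b l))\<^sup>2 + (if l = i then (real j)\<^sup>2 - 2 * real j * \<beta> else 0)" for l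
    proof (cases "l = i")
      case True
      have "\<beta> = of_int s * of_int (b i)" using arg_cong[OF sb, of real_of_int] by (simp add: \<beta>_def)
      moreover have "(of_int s)\<^sup>2 = (1::real)" using s by auto
      moreover have "real_of_int (u l) = of_int (b i) - of_int s * real j" using True by (simp add: j(2) m_def)
      ultimately show ?thesis using True by (simp add: power2_diff power_mult_distrib)
    next
      case False
      then show ?thesis by (simp add: j(2) m_def)
    qed
    then have "sqn n u = (\<Sum>l<n. (of_int (b l))\<^sup>2 + (if l = i then (real j)\<^sup>2 - 2 * real j * \<beta> else 0))"
      unfolding sqn_def by simp
    also have "\<dots> = sqn n b + ((real j)\<^sup>2 - 2 * real j * \<beta>)"
      using i by (simp add: sum.distrib sqn_def)
    finally have sq: "sqn n u = sqn n b + ((real j)\<^sup>2 - 2 * real j * \<beta>)" .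
    obtain c where c: "g u = Fin c" using us by (cases "g u") (auto simp: supp_def)
    have cC: "- C0 \<le> c"
      using C0(2)[of "\<lambda>l. u l - b l"] c by (cases "f (\<lambda>l. u l - b l)") (auto simp: g_def mono_mult_eq)
    have "twist (par n K) g u \<le> twist (par n K) g b" using u by (simp add: argmin_def)
    then have "c + par n K u \<le> par n K b" using c gb by (simp add: twist_def zero_trop_def)
    then have "c \<le> (sqn n u - sqn n b) / (2 * real K)" by (simp add: par_def diff_divide_distrib)
    also have "\<dots> = - (real j * (2 * \<beta> - real j)) / (2 * real K)"
      by (simp add: sq power2_eq_square algebra_simps)
    also have "\<dots> \<le> - \<beta> / (2 * real K)"
    proof (rule divide_right_mono)
      have "1 * \<beta> \<le> real j * (2 * \<beta> - real j)"
        using j1 j(1) \<beta>(1) by (intro mult_mono) auto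
      then show "- (real j * (2 * \<beta> - real j)) \<le> - \<beta>" by simp
    qed simp
    also have "\<dots> < - C0" using \<beta>(2) K by (simp add: field_simps)
    finally show False using cC by simp
  qed
  moreover have "0 \<le> real d + 2 * C0" using C0 by simp
  ultimately show ?thesis by blast
qed

lemma coordinate_bound:
  assumes I: "laurent_ideal UNIV n I" and d: "has_rank n I d"
  obtains C where "0 \<le> C"
    "\<And>K r B b i. 0 < K \<Longrightarrow> B \<subseteq> box n r \<Longrightarrow>
      (\<forall>f\<in>I. f \<noteq> tzero \<longrightarrow> supp f \<subseteq> box n r \<longrightarrow> \<not> argmin (twist (par n K) f) \<subseteq> B) \<Longrightarrow>
      b \<in> B \<Longrightarrow> i < n \<Longrightarrow> \<bar>of_int (b i)\<bar> \<le> C * real K"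
proof -
  define P where "P i s C \<longleftrightarrow> 0 \<le> C \<and> (\<forall>K r B b. 0 < K \<longrightarrow> B \<subseteq> box n r \<longrightarrow>
      (\<forall>f\<in>I. f \<noteq> tzero \<longrightarrow> supp f \<subseteq> box n r \<longrightarrow> \<not> argmin (twist (par n K) f) \<subseteq> B) \<longrightarrow>
      b \<in> B \<longrightarrow> \<bar>b i\<bar> = s * b i \<longrightarrow> \<bar>of_int (b i)\<bar> \<le> C * real K)" for i s C
  have "\<exists>C. P i s C" if "i < n" "s \<in> {1, -1}" for i s
    unfolding P_def by (rule axis_bound[OF I d that])
  then obtain c where c: "\<And>i s. i < n \<Longrightarrow> s \<in> {1, -1} \<Longrightarrow> P i s (c i s)"
    by metis
  define C where "C = (\<Sum>i<n. c i 1 + c i (-1))"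
  have pos: "0 \<le> c i 1" "0 \<le> c i (-1)" if "i < n" for i
    using c[OF that] by (simp_all add: P_def)
  have cC: "c i s \<le> C" if "i < n" "s \<in> {1, -1}" for i s
  proof -
    have "c i 1 + c i (-1) \<le> C"
      unfolding C_def using that pos by (intro member_le_sum) (auto intro: add_nonneg_nonneg)
    then show ?thesis using that pos[OF that(1)] by auto
  qed
  show thesis
  proof (rule that[of C])
    show "0 \<le> C" unfolding C_def using pos by (intro sum_nonneg) (auto intro: add_nonneg_nonneg)
    fix K r B b i
    assume *: "0 < K" "B \<subseteq> box n r"
      "\<forall>f\<in>I. f \<noteq> tzero \<longrightarrow> supp f \<subseteq> box n r \<longrightarrow> \<not> argmin (twist (par n K) f) \<subseteq> B" "b \<in> B" "i < n"
    define s :: int where "s = (if b i \<ge> 0 then 1 else -1)"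
    have s: "s \<in> {1, -1}" "\<bar>b i\<bar> = s * b i" by (auto simp: s_def)
    have "\<bar>of_int (b i)\<bar> \<le> c i s * real K" using c[OF *(5) s(1), unfolded P_def] *(1-4) s(2) by blast
    also have "\<dots> \<le> C * real K" using cC[OF *(5) s(1)] by (intro mult_right_mono) auto
    finally show "\<bar>of_int (b i)\<bar> \<le> C * real K" .
  qed
qed

section \<open>Covering the cube by clusters\<close>

text \<open>Points are functions on all of \<open>nat\<close>; freezing the coordinates from
  \<open>n\<close> on at \<open>0\<close> makes the cube a product of compact sets, so Tychonoff's
  theorem applies.\<close>

lemma compact_cube:
  "compact {x :: nat \<Rightarrow> real. (\<forall>i<n. \<bar>x i\<bar> \<le> C) \<and> (\<forall>i\<ge>n. x i = 0)}"
proof -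
  define S where "S i = (if i < n then {-C..C} else {0::real})" for i
  have "compactin (product_topology (\<lambda>i. euclidean) UNIV) (PiE UNIV S)"
    by (subst compactin_PiE) (auto simp: S_def)
  then have "compact (PiE UNIV S)" by (simp add: euclidean_product_topology)
  moreover have "PiE UNIV S = {x. (\<forall>i<n. \<bar>x i\<bar> \<le> C) \<and> (\<forall>i\<ge>n. x i = 0)}"
  proof (intro equalityI subsetI)
    fix x assume "x \<in> PiE UNIV S"
    then have x: "x i \<in> S i" for i by auto
    have "\<bar>x i\<bar> \<le> C" if "i < n" for i
      using x[of i] that by (auto simp: S_def)
    moreover have "x i = 0" if "i \<ge> n" for i
      using x[of i] that by (simp add: S_def)
    ultimately show "x \<in> {x. (\<forall>i<n. \<bar>x i\<bar> \<le> C) \<and> (\<forall>i\<ge>n. x i = 0)}"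
      by simp
  next
    fix x assume x: "x \<in> {x. (\<forall>i<n. \<bar>x i\<bar> \<le> C) \<and> (\<forall>i\<ge>n. x i = 0)}"
    have "x i \<in> S i" for i
      using x by (cases "i < n") (auto simp: S_def abs_le_iff minus_le_iff)
    then show "x \<in> PiE UNIV S" by auto
  qed
  ultimately show ?thesis by simp
qed

lemma open_l1_ball: "open {x :: nat \<Rightarrow> real. (\<Sum>i<n. \<bar>x i - w i\<bar>) < \<eta>}"
proof (rule open_Collect_less)
  show "continuous_on UNIV (\<lambda>x :: nat \<Rightarrow> real. \<Sum>i<n. \<bar>x i - w i\<bar>)"
    by (intro continuous_intros continuous_on_product_coordinates)
qed (rule continuous_on_const)

text \<open>The order of choices is decisive: \<open>C\<close> and the radii \<open>\<eta> w\<close>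
  do not depend on \<open>K\<close>, so the finite cover \<open>W\<close> is fixed before
  \<open>K\<close> is taken large for all its members; the box and \<open>B\<close> come
  last.\<close>

lemma rank_le_sum_init_ranks:
  assumes I: "laurent_ideal UNIV n I" and lin: "trop_linear_space I" and d: "has_rank n I d"
    and rk: "\<And>w. w \<in> rvec n \<Longrightarrow> has_rank n (init_ideal n w I) (rk w)"
  obtains W where "finite W" "W \<subseteq> rvec n" "d \<le> (\<Sum>w\<in>W. rk w)"
proof -
  obtain C where C: "0 \<le> C" "\<And>K r B b i. 0 < K \<Longrightarrow> B \<subseteq> box n r \<Longrightarrow>
      (\<forall>f\<in>I. f \<noteq> tzero \<longrightarrow> supp f \<subseteq> box n r \<longrightarrow> \<not> argmin (twist (par n K) f) \<subseteq> B) \<Longrightarrow>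
      b \<in> B \<Longrightarrow> i < n \<Longrightarrow> \<bar>of_int (b i)\<bar> \<le> C * real K"
    using coordinate_bound[OF I d] by blast
  define Q where "Q = {x :: nat \<Rightarrow> real. (\<forall>i<n. \<bar>x i\<bar> \<le> C) \<and> (\<forall>i\<ge>n. x i = 0)}"
  have Qr: "Q \<subseteq> rvec n" by (auto simp: Q_def rvec_def)
  define P where "P w \<eta> K \<longleftrightarrow> (\<forall>A B. finite B \<longrightarrow>
       (\<forall>u\<in>expo n. (\<forall>i<n. \<bar>of_int (u i)\<bar> \<le> real K * (\<bar>w i\<bar> + 1)) \<longrightarrow> u \<in> A) \<longrightarrow> B \<subseteq> expo n \<longrightarrow>
       (\<forall>f\<in>I. f \<noteq> tzero \<longrightarrow> supp f \<subseteq> A \<longrightarrow> \<not> argmin (twist (par n K) f) \<subseteq> B) \<longrightarrow>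
       card {b \<in> B. (\<Sum>i<n. \<bar>of_int (b i) + real K * w i\<bar>) < \<eta> * real K} \<le> rk w)" for w \<eta> K
  have "\<exists>\<eta>>0. \<forall>\<^sub>F K in sequentially. P w \<eta> K" if "w \<in> Q" for w
  proof -
    have "w \<in> rvec n" using that Qr by auto
    from cluster_bound[OF I lin rk[OF this], folded P_def]
    obtain e where "0 < e" "\<forall>\<^sub>F K in sequentially. P w e K" .
    then show ?thesis by auto
  qed
  then obtain \<eta> where \<eta>: "\<And>w. w \<in> Q \<Longrightarrow> 0 < \<eta> w" "\<And>w. w \<in> Q \<Longrightarrow> \<forall>\<^sub>F K in sequentially. P w (\<eta> w) K"
    by metis
  define U where "U w = {x :: nat \<Rightarrow> real. (\<Sum>i<n. \<bar>x i - w i\<bar>) < \<eta> w}" for w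
  have "compact Q" unfolding Q_def by (rule compact_cube)
  moreover have "open (U w)" for w unfolding U_def by (rule open_l1_ball)
  moreover have "Q \<subseteq> (\<Union>w\<in>Q. U w)" using \<eta>(1) by (auto simp: U_def)
  ultimately obtain W where W: "W \<subseteq> Q" "finite W" "Q \<subseteq> (\<Union>w\<in>W. U w)"
    by (metis compactE_image)
  obtain S where S: "indep n I S" "card S = d" using d by (auto simp: has_rank_def)
  have fS: "finite S" and SE: "S \<subseteq> expo n" using S by (auto simp: indep_def)
  define M where "M = (\<Sum>u\<in>S. l1 n u)"
  have M: "\<bar>u i\<bar> \<le> M" if "u \<in> S" "i < n" for u i
  proof -
    have "\<bar>u i\<bar> \<le> l1 n u" unfolding l1_def using that by (intro member_le_sum) auto
    also have "\<dots> \<le> M" unfolding M_def using that fS by (intro member_le_sum) (auto simp: l1_nonneg)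
    finally show ?thesis .
  qed
  have "\<forall>\<^sub>F K in sequentially. \<forall>w\<in>W. P w (\<eta> w) K"
    using W \<eta>(2) by (intro eventually_ball_finite) auto
  moreover have "\<forall>\<^sub>F K in sequentially. max 0 (real_of_int M) < real K"
    using filterlim_real_sequentially by (rule filterlim_at_top_dense[THEN iffD1, rule_format])
  ultimately have "\<forall>\<^sub>F K in sequentially. (\<forall>w\<in>W. P w (\<eta> w) K) \<and> max 0 (real_of_int M) < real K"
    by (rule eventually_conj)
  then have "\<exists>K. (\<forall>w\<in>W. P w (\<eta> w) K) \<and> max 0 (real_of_int M) < real K"
    by (rule eventually_happens'[OF sequentially_bot])
  then obtain K where K: "\<And>w. w \<in> W \<Longrightarrow> P w (\<eta> w) K" "0 < K" "real_of_int M < real K" by auto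
  \<comment> \<open>Large enough to contain the region that \<open>cluster_bound\<close> prescribes
    around every centre in the cube; since \<open>K\<close> exceeds \<open>M\<close>, it also
    contains \<open>S\<close>.\<close>
  define r where "r = \<lceil>real K * (C + 1)\<rceil>"
  have rK: "real K * (C + 1) \<le> real_of_int r" by (simp add: r_def)
  have "real K \<le> real K * (C + 1)" using C(1) by (simp add: algebra_simps)
  then have "M \<le> r" using rK K(3) by linarith
  then have Sbox: "S \<subseteq> box n r" using M SE by (force simp: box_def)
  have "\<forall>F\<in>twist (par n K) ` I. F \<noteq> tzero \<longrightarrow> \<not> supp F \<subseteq> S"
    using S(1) by (simp add: indep_def)
  from initial_independent_set[OF trop_linear_space_twist[OF lin] finite_box Sbox this]
  obtain B where B: "B \<subseteq> box n r" "card S \<le> card B"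
    "\<forall>F\<in>twist (par n K) ` I. F \<noteq> tzero \<longrightarrow> supp F \<subseteq> box n r \<longrightarrow> \<not> argmin F \<subseteq> B" .
  have ind: "\<forall>f\<in>I. f \<noteq> tzero \<longrightarrow> supp f \<subseteq> box n r \<longrightarrow> \<not> argmin (twist (par n K) f) \<subseteq> B"
    using B(3) by simp
  have finB: "finite B" using finite_subset[OF B(1) finite_box] .
  have BE: "B \<subseteq> expo n" using B(1) by (auto simp: box_def)
  define cl where "cl w = {b \<in> B. (\<Sum>i<n. \<bar>of_int (b i) + real K * w i\<bar>) < \<eta> w * real K}" for w
  have "card (cl w) \<le> rk w" if w: "w \<in> W" for w
  proof -
    have "u \<in> box n r" if u: "u \<in> expo n" "\<forall>i<n. \<bar>of_int (u i)\<bar> \<le> real K * (\<bar>w i\<bar> + 1)" for u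
    proof -
      have "\<bar>u i\<bar> \<le> r" if "i < n" for i
      proof -
        have "\<bar>w i\<bar> \<le> C" using w W(1) that by (auto simp: Q_def)
        then have "real K * (\<bar>w i\<bar> + 1) \<le> real K * (C + 1)" by (intro mult_left_mono) auto
        then have "\<bar>of_int (u i)\<bar> \<le> real_of_int r" using u(2) that rK by force
        then show ?thesis by linarith
      qed
      then show ?thesis using u(1) by (simp add: box_def)
    qed
    then show ?thesis
      using K(1)[OF w] finB BE ind unfolding P_def cl_def by blast
  qed
  moreover have "B \<subseteq> (\<Union>w\<in>W. cl w)"
  proof
    fix b assume b: "b \<in> B"
    define x where "x i = - of_int (b i) / real K" for i
    have "\<bar>x i\<bar> \<le> C" if "i < n" for i
      using C(2)[OF K(2) B(1) ind b that] K(2) by (simp add: x_def field_simps)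
    moreover have "x i = 0" if "i \<ge> n" for i using b BE that by (auto simp: x_def expo_def)
    ultimately have "x \<in> Q" by (simp add: Q_def)
    then obtain w where w: "w \<in> W" "(\<Sum>i<n. \<bar>x i - w i\<bar>) < \<eta> w" using W(3) by (auto simp: U_def)
    have "(\<Sum>i<n. \<bar>of_int (b i) + real K * w i\<bar>) = (\<Sum>i<n. \<bar>x i - w i\<bar> * real K)"
    proof (rule sum.cong[OF refl])
      fix i
      have "of_int (b i) + real K * w i = - ((x i - w i) * real K)"
        using K(2) by (simp add: x_def field_simps)
      then show "\<bar>of_int (b i) + real K * w i\<bar> = \<bar>x i - w i\<bar> * real K"
        by (simp add: abs_mult)
    qed
    also have "\<dots> = (\<Sum>i<n. \<bar>x i - w i\<bar>) * real K" by (simp add: sum_distrib_right)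
    also have "\<dots> < \<eta> w * real K" using w(2) K(2) by simp
    finally show "b \<in> (\<Union>w\<in>W. cl w)" using w(1) b by (auto simp: cl_def)
  qed
  ultimately have "card B \<le> (\<Sum>w\<in>W. rk w)"
  proof -
    have "finite (\<Union>w\<in>W. cl w)" using W(2) finB by (auto simp: cl_def)
    then have "card B \<le> card (\<Union>w\<in>W. cl w)" using \<open>B \<subseteq> (\<Union>w\<in>W. cl w)\<close> by (intro card_mono)
    also have "\<dots> \<le> (\<Sum>w\<in>W. card (cl w))" using W(2) by (rule card_UN_le)
    also have "\<dots> \<le> (\<Sum>w\<in>W. rk w)" using \<open>\<And>w. w \<in> W \<Longrightarrow> card (cl w) \<le> rk w\<close> by (rule sum_mono)
    finally show ?thesis .
  qed
  then show thesis using that[of W] W Qr B(2) S(2) by auto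
qed

theorem theorem5p10:
  fixes n :: nat and I :: "((nat \<Rightarrow> int) \<Rightarrow> trop) set"
  assumes "trop_laurent_ideal UNIV n I"
    and "zero_dimensional UNIV n I"
  shows "finite (trop_variety n I) \<and>
         tdeg UNIV n I = (\<Sum>w\<in>trop_variety n I. mult n I w)"
proof -
  let ?V = "trop_variety n I"
  have I: "laurent_ideal UNIV n I"
    using assms(1) by (auto simp: trop_laurent_ideal_def laurent_ideal_def)
  have lin: "trop_linear_space I"
    unfolding trop_linear_space_def
  proof (intro conjI ballI allI)
    show "elimination_axiom I" using assms(1) by (simp add: trop_laurent_ideal_def)
    fix f c assume "f \<in> I"
    then have "mono_mult c (\<lambda>i. 0) f \<in> I" using laurent_ideal_mult[OF I] by (simp add: expo_def)
    then show "(\<lambda>u. Fin c + f u) \<in> I" by (simp add: mono_mult_eq)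
  qed
  obtain d where d: "has_rank n I d" using zero_dimensional_has_rank[OF I assms(2)] .
  have sum_le: "(\<Sum>w\<in>W. card (S w)) \<le> d"
    if "finite W" "W \<subseteq> rvec n" "\<And>w. w \<in> W \<Longrightarrow> indep n (init_ideal n w I) (S w)" for W S
    using indep_disjoint_union[OF I that] d unfolding has_rank_def by auto
  \<comment> \<open>The upper bound for a single point already bounds the independent sets of its
    initial ideal by \<open>d\<close>.\<close>
  have "\<exists>r. has_rank n (init_ideal n w I) r" if w: "w \<in> rvec n" for w
  proof -
    have "card S \<le> d" if "indep n (init_ideal n w I) S" for S
      using sum_le[of "{w}" "\<lambda>_. S"] that w by simp
    then show ?thesis using has_rank_exists[of n "init_ideal n w I" d] by blast
  qed
  then obtain rk where rk: "\<And>w. w \<in> rvec n \<Longrightarrow> has_rank n (init_ideal n w I) (rk w)" by metis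
  have Vr: "?V \<subseteq> rvec n" by (auto simp: trop_variety_def)
  have "card W \<le> d" if "W \<subseteq> ?V" "finite W" for W
    using sum_le[of W "\<lambda>_. {\<lambda>i. 0}"] indep_init_singleton[OF I] that Vr by auto
  then have fin: "finite ?V" using finite_if_finite_subsets_card_bdd by blast
  have "(\<Sum>w\<in>?V. rk w) \<le> d"
  proof -
    have "\<exists>S. indep n (init_ideal n w I) S \<and> card S = rk w" if "w \<in> ?V" for w
      using rk[of w] that Vr by (auto simp: has_rank_def)
    then obtain S where S: "\<And>w. w \<in> ?V \<Longrightarrow> indep n (init_ideal n w I) (S w) \<and> card (S w) = rk w" by metis
    then show ?thesis using sum_le[OF fin Vr, of S] by simp
  qed
  moreover have "d \<le> (\<Sum>w\<in>?V. rk w)"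
  proof -
    obtain W where W: "finite W" "W \<subseteq> rvec n" "d \<le> (\<Sum>w\<in>W. rk w)"
      using rank_le_sum_init_ranks[OF I lin d rk] by blast
    \<comment> \<open>The centres of the cover need not lie on the variety; those that do not drop
      out of the sum.\<close>
    have "rk w = 0" if "w \<in> rvec n" "w \<notin> ?V" for w
      using rk[OF that(1)] indep_init_empty[OF I that] unfolding has_rank_def by (metis card.empty)
    then have "(\<Sum>w\<in>W. rk w) = (\<Sum>w\<in>W \<inter> ?V. rk w)"
      using W(1,2) by (intro sum.mono_neutral_right) blast+
    also have "\<dots> \<le> (\<Sum>w\<in>?V. rk w)" using fin by (intro sum_mono2) auto
    finally show ?thesis using W(3) by simp
  qed
  moreover have "mult n I w = real (rk w)" if "w \<in> ?V" for w
    unfolding mult_def using tdeg_eq_rank[OF laurent_ideal_init[OF I] rk[of w]] that Vr by auto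
  ultimately have "d = (\<Sum>w\<in>?V. rk w)" "(\<Sum>w\<in>?V. mult n I w) = (\<Sum>w\<in>?V. real (rk w))"
    by simp_all
  then show ?thesis
    using fin tdeg_eq_rank[OF I d] by simp
qed

end
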